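(* Let $q$ be a prime power and let $r=q^2+q+1$. Then there is a bijection $\psi$ from the set of points of $\mathrm{PG}(2,q)$ to $[r]$ such that, for the permutation group $\Psi=\{f_\psi : f\in \mathrm{PGL}(3,q)\}\le \mathcal{S}_r$ (a permutation representation of $\mathrm{PGL}(3,q)$), the number of sequences in $\mathcal{S}_{r,4}$ that are covered by exactly $|\Psi|/4!$ permutations in $\Psi$ is greater than \[ \left(1-\frac1q\right)|\mathcal{S}_{r,4}|. \]
   Context: $[r]=\{0,\dots,r-1\}$, $\mathcal{S}_r$ is the group of permutations of $[r]$, and $\mathcal{S}_{r,4}$ is the set of ordered sequences $(s_1,\dots,s_4)$ of 4 distinct elements of $[r]$. A permutation $\pi\in\mathcal{S}_r$ covers $s\in\mathcal{S}_{r,4}$ if $\pi^{-1}(s_i)<\pi^{-1}(s_{i+1})$ for $i=1,2,3$. $\mathrm{PG}(2,q)$ is the projective plane whose points are the 1-dimensional subspaces of $\mathrm{GF}(q)^3$; it has $r$ points. $\mathrm{PGL}(3,q)$ is the group of projectivities, i.e. permutations of the points induced by matrices in $\mathrm{GL}(3,q)$. For a bijection $\psi$ from the points to $[r]$ and a projectivity $f$, $f_\psi\in\mathcal{S}_r$ is defined by $f_\psi(i)=\psi(f(\psi^{-1}(i)))$. *)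

theory Defs
  imports "HOL-Analysis.Analysis" "HOL-Combinatorics.Permutations"
    "HOL-Number_Theory.Prime_Powers"
begin

text \<open>GF(q) is a type \<open>'a\<close> of sort \<open>{field, finite}\<close> with \<open>CARD('a) = q\<close>.
  A permutation of a set is, as in the library, a function on the whole type that fixes everything
  outside the set (\<open>permutes\<close>), so that cardinalities of sets of permutations are meaningful.\<close>

definition pg_points :: "('a::{field,finite} ^ 3) set set" where
  "pg_points = {L. vec.subspace L \<and> vec.dim L = 1}"

definition pgl :: "(('a::{field,finite} ^ 3) set \<Rightarrow> ('a ^ 3) set) set" where
  "pgl = {f. f permutes pg_points \<and>
             (\<exists>A :: 'a ^ 3 ^ 3. invertible A \<and> (\<forall>L\<in>pg_points. f L = (\<lambda>v. A *v v) ` L))}"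

definition transport_perm ::
  "nat \<Rightarrow> (('a::{field,finite} ^ 3) set \<Rightarrow> nat)
     \<Rightarrow> (('a ^ 3) set \<Rightarrow> ('a ^ 3) set) \<Rightarrow> nat \<Rightarrow> nat" where
  "transport_perm r \<psi> f i = (if i < r then \<psi> (f (inv_into pg_points \<psi> i)) else i)"

definition pgl_rep :: "nat \<Rightarrow> (('a::{field,finite} ^ 3) set \<Rightarrow> nat) \<Rightarrow> (nat \<Rightarrow> nat) set" where
  "pgl_rep r \<psi> = transport_perm r \<psi> ` pgl"

definition distinct_seqs :: "nat \<Rightarrow> nat \<Rightarrow> nat list set" where
  "distinct_seqs r k = {s. length s = k \<and> distinct s \<and> set s \<subseteq> {..<r}}"

definition covers :: "(nat \<Rightarrow> nat) \<Rightarrow> nat list \<Rightarrow> bool" where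
  "covers \<pi> s \<longleftrightarrow> (\<forall>i. Suc i < length s \<longrightarrow> inv \<pi> (s ! i) < inv \<pi> (s ! Suc i))"

text \<open>The images of the projectivities form a group of permutations of \<open>{..<r}\<close>.\<close>

lemma pgl_id: "id \<in> pgl"
proof -
  have "invertible (mat 1 :: 'a ^ 3 ^ 3)"
    unfolding invertible_def by (rule exI[of _ "mat 1"]) simp
  moreover have "id L = (\<lambda>v. (mat 1 :: 'a ^ 3 ^ 3) *v v) ` L" for L
    by simp
  ultimately show ?thesis
    unfolding pgl_def using permutes_id by blast
qed

lemma pgl_comp:
  assumes "f \<in> pgl" "g \<in> pgl" shows "f \<circ> g \<in> pgl"
proof -
  from assms(1) obtain A where f: "f permutes pg_points" "invertible A"
      "\<And>L. L \<in> pg_points \<Longrightarrow> f L = (\<lambda>v. A *v v) ` L"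
    unfolding pgl_def by blast
  from assms(2) obtain B where g: "g permutes pg_points" "invertible B"
      "\<And>L. L \<in> pg_points \<Longrightarrow> g L = (\<lambda>v. B *v v) ` L"
    unfolding pgl_def by blast
  have "(f \<circ> g) L = (\<lambda>v. (A ** B) *v v) ` L" if "L \<in> pg_points" for L
    using f(3)[of "g L"] g(3)[OF that] permutes_in_image[OF g(1), of L] that
    by (simp add: image_image matrix_vector_mul_assoc)
  then show ?thesis
    unfolding pgl_def using permutes_compose[OF g(1) f(1)] invertible_mult[OF f(2) g(2)] by blast
qed

lemma pgl_inv:
  assumes "f \<in> pgl" shows "inv f \<in> pgl"
proof -
  from assms obtain A where f: "f permutes pg_points" "invertible A"
      "\<And>L. L \<in> pg_points \<Longrightarrow> f L = (\<lambda>v. A *v v) ` L"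
    unfolding pgl_def by blast
  then obtain B where B: "A ** B = mat 1" "B ** A = mat 1"
    unfolding invertible_def by blast
  have "inv f L = (\<lambda>v. B *v v) ` L" if "L \<in> pg_points" for L
  proof -
    have "inv f L \<in> pg_points"
      using permutes_in_image[OF permutes_inv[OF f(1)], of L] that by simp
    from f(3)[OF this] have "L = (\<lambda>v. A *v v) ` inv f L"
      using permutes_inverses(1)[OF f(1)] by simp
    then have "(\<lambda>v. B *v v) ` L = (\<lambda>v. B *v (A *v v)) ` inv f L"
      by (metis image_image)
    then show ?thesis by (simp add: matrix_vector_mul_assoc B)
  qed
  moreover have "invertible B" unfolding invertible_def using B by blast
  ultimately show ?thesis
    unfolding pgl_def using permutes_inv[OF f(1)] by blast
qed

lemma transport_perm_permutes:
  assumes \<psi>: "bij_betw \<psi> pg_points {..<r}" and "f \<in> pgl"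
  shows "transport_perm r \<psi> f permutes {..<r}"
proof (rule bij_imp_permutes)
  have "bij_betw f pg_points pg_points"
    using assms(2) by (auto simp: pgl_def permutes_imp_bij)
  then have "bij_betw (\<psi> \<circ> f \<circ> inv_into pg_points \<psi>) {..<r} {..<r}"
    by (rule bij_betw_trans[OF bij_betw_inv_into[OF \<psi>] bij_betw_trans[OF _ \<psi>]])
  then show "bij_betw (transport_perm r \<psi> f) {..<r} {..<r}"
    by (subst bij_betw_cong[where g = "\<psi> \<circ> f \<circ> inv_into pg_points \<psi>"])
      (auto simp: transport_perm_def)
qed (simp add: transport_perm_def)

lemma transport_perm_comp:
  assumes \<psi>: "bij_betw \<psi> pg_points {..<r}" and "g \<in> pgl"
  shows "transport_perm r \<psi> (f \<circ> g) = transport_perm r \<psi> f \<circ> transport_perm r \<psi> g"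
proof
  fix i
  have g: "g permutes pg_points" using assms(2) by (simp add: pgl_def)
  show "transport_perm r \<psi> (f \<circ> g) i = (transport_perm r \<psi> f \<circ> transport_perm r \<psi> g) i"
  proof (cases "i < r")
    case True
    then have "inv_into pg_points \<psi> i \<in> pg_points"
      using bij_betw_apply[OF bij_betw_inv_into[OF \<psi>], of i] by simp
    then have "g (inv_into pg_points \<psi> i) \<in> pg_points"
      using permutes_in_image[OF g] by simp
    then show ?thesis
      using True bij_betw_apply[OF \<psi>, of "g (inv_into pg_points \<psi> i)"]
        bij_betw_inv_into_left[OF \<psi>]
      by (simp add: transport_perm_def)
  qed (simp add: transport_perm_def)
qed

lemma transport_perm_id:
  assumes "bij_betw \<psi> pg_points {..<r}"
  shows "transport_perm r \<psi> id = id"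
  using bij_betw_inv_into_right[OF assms] by (auto simp: transport_perm_def)

lemma pgl_rep_group:
  assumes \<psi>: "bij_betw \<psi> pg_points {..<r}"
  shows "pgl_rep r \<psi> \<subseteq> {\<pi>. \<pi> permutes {..<r}}"
    and "id \<in> pgl_rep r \<psi>"
    and "\<pi> \<in> pgl_rep r \<psi> \<Longrightarrow> \<sigma> \<in> pgl_rep r \<psi> \<Longrightarrow> \<pi> \<circ> \<sigma> \<in> pgl_rep r \<psi>"
    and "\<pi> \<in> pgl_rep r \<psi> \<Longrightarrow> inv \<pi> \<in> pgl_rep r \<psi>"
proof -
  show "pgl_rep r \<psi> \<subseteq> {\<pi>. \<pi> permutes {..<r}}"
    using transport_perm_permutes[OF \<psi>] by (auto simp: pgl_rep_def)
  show "id \<in> pgl_rep r \<psi>"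
    unfolding pgl_rep_def using transport_perm_id[OF \<psi>] pgl_id by (metis image_eqI)
  show "\<pi> \<circ> \<sigma> \<in> pgl_rep r \<psi>" if "\<pi> \<in> pgl_rep r \<psi>" "\<sigma> \<in> pgl_rep r \<psi>"
  proof -
    from that obtain f g where "f \<in> pgl" "\<pi> = transport_perm r \<psi> f"
        "g \<in> pgl" "\<sigma> = transport_perm r \<psi> g"
      by (auto simp: pgl_rep_def)
    then show ?thesis
      unfolding pgl_rep_def using transport_perm_comp[OF \<psi>, of g f] pgl_comp[of f g]
      by (simp add: rev_image_eqI)
  qed
  show "inv \<pi> \<in> pgl_rep r \<psi>" if "\<pi> \<in> pgl_rep r \<psi>"
  proof -
    from that obtain f where f: "f \<in> pgl" "\<pi> = transport_perm r \<psi> f"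
      by (auto simp: pgl_rep_def)
    have p: "f permutes pg_points" using f(1) by (simp add: pgl_def)
    have "\<pi> \<circ> transport_perm r \<psi> (inv f) = id" "transport_perm r \<psi> (inv f) \<circ> \<pi> = id"
      using transport_perm_comp[OF \<psi> pgl_inv[OF f(1)], of f]
        transport_perm_comp[OF \<psi> f(1), of "inv f"] transport_perm_id[OF \<psi>]
      by (simp_all add: f(2) permutes_inv_o[OF p])
    then have "inv \<pi> = transport_perm r \<psi> (inv f)"
      by (metis inv_unique_comp)
    then show ?thesis using pgl_inv[OF f(1)] by (auto simp: pgl_rep_def)
  qed
qed

end

theory Submission
  imports Defs "HOL-Combinatorics.Multiset_Permutations"
begin

text \<open>
  The group PGL(3,q) is transitive on ordered quadrangles and, for each \<open>i\<close>, on the sequences of four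
  points whose \<open>i\<close>-th point lies off a line through the other three. A sequence in an orbit \<open>\<Omega>\<close> is
  covered by \<open>|PGL(3,q)| / 4!\<close> permutations iff a fraction \<open>1 / 4!\<close> of \<open>\<Omega>\<close> is increasing in the chosen
  ordering of the points. For quadrangles this is automatic. For the other four orbits it means that the
  number of sets consisting of a collinear triple and a point off its line is the same for each
  position of that point. Double counting reduces these conditions to a single one: the median of a
  collinear triple is, on average over all collinear triples, the central position.

  Such an ordering exists: order the affine points lexicographically with respect to an arbitrary
  ordering of the field, put the vertical direction in the centre and half of the other
  directions at either end. The number of collinear triples with median \<open>p\<close> is then invariant under
  reversal of the ordering. If q is odd, one direction and the affine centre are left over. They go
  on either side of the vertical direction and are medians of equally many triples. Thus only
  collinear sequences can fail, and these are fewer than a fraction \<open>1 / q\<close> of all sequences.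
\<close>

section \<open>Collinear triples in a linearly ordered linear space\<close>

lemma sum_pairs_less:
  fixes F :: "nat \<Rightarrow> nat \<Rightarrow> int"
  shows "(\<Sum>(x, y) \<in> {(x, y). x < y \<and> y < r}. F x y) = (\<Sum>y<r. \<Sum>x<y. F x y)"
proof -
  have "(\<Sum>y<r. \<Sum>x<y. F x y) = (\<Sum>(y, x) \<in> Sigma {..<r} lessThan. F x y)"
    by (simp add: sum.Sigma)
  also have "\<dots> = (\<Sum>(x, y) \<in> {(x, y). x < y \<and> y < r}. F x y)"
    by (rule sum.reindex_bij_witness[where i = prod.swap and j = prod.swap]) auto
  finally show ?thesis by simp
qed

lemma sum_lessThan_int: "2 * (\<Sum>x<n. int x) = int n * (int n - 1)"
  by (induction n) (auto simp: algebra_simps)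

lemma sum_pairs_one: "2 * (\<Sum>y<r. \<Sum>x<y. (1::int)) = int r * (int r - 1)"
  using sum_lessThan_int[of r] by simp

lemma sum_pairs_add:
  "2 * (\<Sum>y<r. \<Sum>x<y. int x + int y) = int r * (int r - 1) * (int r - 1)"
proof (induction r)
  case (Suc r)
  then show ?case
    using sum_lessThan_int[of r] by (simp add: sum.distrib algebra_simps)
qed simp

lemma sum_pairs_diff:
  "6 * (\<Sum>y<r. \<Sum>x<y. int y - int x) = int r * (int r - 1) * (int r + 1)"
proof (induction r)
  case (Suc r)
  then show ?case
    using sum_lessThan_int[of r] by (simp add: sum_subtractf algebra_simps)
qed simp

section \<open>Sets of sequences closed under rearrangement\<close>

lemma finite_distinct_seqs [simp]: "finite (distinct_seqs r k)"
  by (rule finite_subset[OF _ finite_lists_length_eq[of "{..<r}" k]]) (auto simp: distinct_seqs_def)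

text \<open>Such a set is the disjoint union, over the underlying sets \<open>A\<close>, of all
  \<open>fact k\<close> arrangements of \<open>A\<close>, and exactly one arrangement of each
  \<open>A\<close> is increasing.\<close>

lemma card_symmetric_seqs:
  assumes sub: "\<Omega> \<subseteq> distinct_seqs r k"
    and closed: "\<And>s t. \<lbrakk>s \<in> \<Omega>; t \<in> distinct_seqs r k; set t = set s\<rbrakk> \<Longrightarrow> t \<in> \<Omega>"
  shows "card \<Omega> = fact k * card {s \<in> \<Omega>. sorted_wrt (<) s}"
proof -
  have fin: "finite \<Omega>"
    using sub finite_subset by fastforce
  have \<Omega>: "\<Omega> = (\<Union>A \<in> set ` \<Omega>. permutations_of_set A)"
  proof (intro equalityI subsetI)
    fix t assume "t \<in> (\<Union>A \<in> set ` \<Omega>. permutations_of_set A)"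
    then obtain s where s: "s \<in> \<Omega>" "set t = set s" "distinct t"
      by (auto simp: permutations_of_set_def)
    moreover have "t \<in> distinct_seqs r k"
      using s sub distinct_card[of s] distinct_card[of t] by (auto simp: distinct_seqs_def)
    ultimately show "t \<in> \<Omega>"
      using closed by blast
  qed (use sub in \<open>auto simp: permutations_of_set_def distinct_seqs_def\<close>)
  have cardA: "card A = k" "finite A" if "A \<in> set ` \<Omega>" for A
    using that sub by (auto simp: distinct_seqs_def distinct_card)
  have "card \<Omega> = (\<Sum>A \<in> set ` \<Omega>. card (permutations_of_set A))"
    by (subst \<Omega>, rule card_UN_disjoint) (simp add: fin, simp, auto simp: permutations_of_set_def)
  also have "\<dots> = fact k * card (set ` \<Omega>)"
    by (simp add: cardA)
  also have "set ` \<Omega> = set ` {s \<in> \<Omega>. sorted_wrt (<) s}"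
  proof (intro equalityI subsetI)
    fix A assume "A \<in> set ` \<Omega>"
    then obtain s where s: "s \<in> \<Omega>" "A = set s" by blast
    let ?t = "sorted_list_of_set A"
    have t: "set ?t = set s" "distinct ?t" "sorted_wrt (<) ?t"
      using s(2) by (auto simp: strict_sorted_iff)
    have "?t \<in> \<Omega>"
      using closed[OF s(1), of ?t] t sub s(1)
      by (auto simp: distinct_seqs_def s(2) distinct_card)
    with t s(2) show "A \<in> set ` {s \<in> \<Omega>. sorted_wrt (<) s}"
      by (metis (mono_tags, lifting) image_eqI mem_Collect_eq)
  qed auto
  also have "card \<dots> = card {s \<in> \<Omega>. sorted_wrt (<) s}"
    by (rule card_image) (auto simp: inj_on_def strict_sorted_equal)
  finally show ?thesis .
qed

lemma card_filter_Un:
  assumes "finite A" "finite B" "A \<inter> B = {}"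
  shows "card {s \<in> A \<union> B. P s} = card {s \<in> A. P s} + card {s \<in> B. P s}"
proof -
  have "{s \<in> A \<union> B. P s} = {s \<in> A. P s} \<union> {s \<in> B. P s}" by blast
  then show ?thesis using assms by (simp add: card_Un_disjoint disjoint_iff)
qed

text \<open>The points are identified with their positions in the ordering; \<open>C\<close> is
  collinearity, and \<open>m\<close> counts the points of a line beyond two given ones, so
  \<open>m\<close> is q - 1 in the plane. Only these incidence properties enter the count of
  increasing sequences.\<close>

locale ordered_linear_space =
  fixes r m :: nat and C :: "nat \<Rightarrow> nat \<Rightarrow> nat \<Rightarrow> bool"
  assumes C_swap12: "C a b c \<Longrightarrow> C b a c"
    and C_swap23: "C a b c \<Longrightarrow> C a c b"
    and C_line: "\<lbrakk>a < r; b < r; c < r; d < r; a \<noteq> b; C a b c; C a b d\<rbrakk> \<Longrightarrow> C a c d"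
    and card_line: "\<lbrakk>a < r; b < r; a \<noteq> b\<rbrakk> \<Longrightarrow> card {c. c < r \<and> c \<noteq> a \<and> c \<noteq> b \<and> C a b c} = m"
begin

definition triples :: "(nat \<times> nat \<times> nat) set" where
  "triples = {(a, b, c). a < b \<and> b < c \<and> c < r \<and> C a b c}"

lemma C_perm:
  "C a b c \<longleftrightarrow> C a c b" "C a b c \<longleftrightarrow> C b a c" "C a b c \<longleftrightarrow> C b c a"
  "C a b c \<longleftrightarrow> C c a b" "C a b c \<longleftrightarrow> C c b a"
  by (meson C_swap12 C_swap23)+

lemma finite_triples [simp]: "finite triples"
  by (rule finite_subset[of _ "{..<r} \<times> {..<r} \<times> {..<r}"]) (auto simp: triples_def)

text \<open>The line through a pair \<open>x < y\<close> carries \<open>m\<close> further points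
  \<open>z\<close>. According to whether \<open>z\<close> lies above, below or between the two, the
  pair is the lower, the upper or the outer pair of the resulting collinear triple.\<close>

lemma sum_triples_pairs:
  fixes F :: "nat \<Rightarrow> nat \<Rightarrow> int"
  shows "(\<Sum>(a, b, c) \<in> triples. F a b + F b c + F a c)
       = int m * (\<Sum>y<r. \<Sum>x<y. F x y)"
proof -
  define S where "S P = {(x, y, z). x < y \<and> y < r \<and> z < r \<and> z \<noteq> x \<and> z \<noteq> y \<and> C x y z \<and> P x y z}"
    for P :: "nat \<Rightarrow> nat \<Rightarrow> nat \<Rightarrow> bool"
  let ?F = "\<lambda>(x, y, z). F x y"
  have fin: "finite (S P)" for P
    by (rule finite_subset[of _ "{..<r} \<times> {..<r} \<times> {..<r}"]) (auto simp: S_def)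
  have "sum ?F (S (\<lambda>_ _ _. True))
      = (\<Sum>(p, z) \<in> Sigma {(x, y). x < y \<and> y < r}
           (\<lambda>(x, y). {z. z < r \<and> z \<noteq> x \<and> z \<noteq> y \<and> C x y z}). F (fst p) (snd p))"
    by (rule sum.reindex_bij_witness[where i = "\<lambda>((x, y), z). (x, y, z)" and j = "\<lambda>(x, y, z). ((x, y), z)"])
      (auto simp: S_def)
  also have "\<dots> = (\<Sum>p \<in> {(x, y). x < y \<and> y < r}. int m * F (fst p) (snd p))"
  proof (subst sum.Sigma[symmetric])
    show "finite {(x, y). x < y \<and> y < r}"
      by (rule finite_subset[of _ "{..<r} \<times> {..<r}"]) auto
  qed (auto intro!: sum.cong simp: card_line)
  also have "\<dots> = int m * (\<Sum>y<r. \<Sum>x<y. F x y)"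
    by (simp add: sum_pairs_less[symmetric] sum_distrib_left case_prod_unfold)
  finally have total: "sum ?F (S (\<lambda>_ _ _. True)) = int m * (\<Sum>y<r. \<Sum>x<y. F x y)" .
  have split: "S (\<lambda>_ _ _. True) = S (\<lambda>x y z. y < z) \<union> (S (\<lambda>x y z. z < x) \<union> S (\<lambda>x y z. x < z \<and> z < y))"
    by (auto simp: S_def)
  have "S (\<lambda>x y z. y < z) \<inter> (S (\<lambda>x y z. z < x) \<union> S (\<lambda>x y z. x < z \<and> z < y)) = {}"
    "S (\<lambda>x y z. z < x) \<inter> S (\<lambda>x y z. x < z \<and> z < y) = {}"
    by (auto simp: S_def)
  then have "sum ?F (S (\<lambda>_ _ _. True))
      = sum ?F (S (\<lambda>x y z. y < z)) + (sum ?F (S (\<lambda>x y z. z < x)) + sum ?F (S (\<lambda>x y z. x < z \<and> z < y)))"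
    unfolding split by (simp only: sum.union_disjoint fin finite_UnI)
  moreover have "sum ?F (S (\<lambda>x y z. y < z)) = (\<Sum>(a, b, c) \<in> triples. F a b)"
    by (rule sum.cong) (auto simp: S_def triples_def)
  moreover have "sum ?F (S (\<lambda>x y z. z < x)) = (\<Sum>(a, b, c) \<in> triples. F b c)"
    by (rule sum.reindex_bij_witness[where i = "\<lambda>(a, b, c). (b, c, a)" and j = "\<lambda>(x, y, z). (z, x, y)"])
      (auto simp: S_def triples_def C_perm)
  moreover have "sum ?F (S (\<lambda>x y z. x < z \<and> z < y)) = (\<Sum>(a, b, c) \<in> triples. F a c)"
    by (rule sum.reindex_bij_witness[where i = "\<lambda>(a, b, c). (a, c, b)" and j = "\<lambda>(x, y, z). (x, z, y)"])
      (auto simp: S_def triples_def dest: C_swap23)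
  ultimately show ?thesis
    using total by (simp add: case_prod_unfold sum.distrib)
qed

text \<open>Summing over the pairs contained in a collinear triple \<open>a < b < c\<close> determines the sums of
  \<open>a + b + c\<close> and of \<open>c - a\<close> over all such triples. Hence only the sum of the medians depends on the
  ordering of the points.\<close>

definition med_balanced :: bool where
  "med_balanced \<longleftrightarrow> (\<Sum>(a, b, c) \<in> triples. 2 * int b - (int r - 1)) = 0"

text \<open>Weighting pairs by 1, by \<open>x + y\<close> and by \<open>y - x\<close> gives the
  number of triples and the sums of \<open>a + b + c\<close> and of \<open>c - a\<close>. With the
  balanced medians these determine all three coordinate sums: each of the four gaps around a triple
  contains (r - 3) / 4 points on average.\<close>

lemma gap_sums:
  assumes med_balanced
  shows "(\<Sum>(a, b, c) \<in> triples. int b - int a - 1) = (\<Sum>(a, b, c) \<in> triples. int a)"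
    and "(\<Sum>(a, b, c) \<in> triples. int c - int b - 1) = (\<Sum>(a, b, c) \<in> triples. int a)"
    and "(\<Sum>(a, b, c) \<in> triples. int r - 1 - int c) = (\<Sum>(a, b, c) \<in> triples. int a)"
proof -
  let ?n = "int (card triples)"
  let ?A = "\<Sum>(a, b, c) \<in> triples. int a"
  let ?B = "\<Sum>(a, b, c) \<in> triples. int b"
  let ?C = "\<Sum>(a, b, c) \<in> triples. int c"
  \<comment> \<open>\<open>P\<close> is six times the number of collinear triples and a common
    factor of the sums below.\<close>
  define P where "P = int m * (int r * (int r - 1))"
  have n: "6 * ?n = P"
  proof -
    have "3 * ?n = int m * (\<Sum>y<r. \<Sum>x<y. 1)"
      using sum_triples_pairs[of "\<lambda>_ _. 1"] by (simp add: case_prod_unfold)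
    with sum_pairs_one[of r] show ?thesis
      unfolding P_def by algebra
  qed
  have "(\<Sum>(a, b, c) \<in> triples. (int a + int b) + (int b + int c) + (int a + int c)) = 2 * (?A + ?B + ?C)"
    by (simp add: case_prod_unfold sum.distrib sum_distrib_left[symmetric])
  then have "4 * (?A + ?B + ?C) = P * (int r - 1)"
    using sum_triples_pairs[of "\<lambda>x y. int x + int y"] sum_pairs_add[of r]
    unfolding P_def by algebra
  then have s: "2 * (?A + ?B + ?C) = 3 * (?n * int r) - 3 * ?n"
    by (simp add: n[symmetric] algebra_simps)
  have "(\<Sum>(a, b, c) \<in> triples. (int b - int a) + (int c - int b) + (int c - int a)) = 2 * (?C - ?A)"
    by (simp add: case_prod_unfold sum.distrib sum_subtractf sum_distrib_left[symmetric])
  then have "12 * (?C - ?A) = P * (int r + 1)"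
    using sum_triples_pairs[of "\<lambda>x y. int y - int x"] sum_pairs_diff[of r]
    unfolding P_def by algebra
  then have d: "2 * (?C - ?A) = ?n * int r + ?n"
    by (simp add: n[symmetric] algebra_simps)
  have b: "2 * ?B = ?n * int r - ?n"
    using assms unfolding med_balanced_def
    by (simp add: case_prod_unfold sum_subtractf sum.distrib sum_distrib_left[symmetric] algebra_simps)
  show "(\<Sum>(a, b, c) \<in> triples. int b - int a - 1) = ?A"
    "(\<Sum>(a, b, c) \<in> triples. int c - int b - 1) = ?A"
    "(\<Sum>(a, b, c) \<in> triples. int r - 1 - int c) = ?A"
    using s d b by (simp_all add: case_prod_unfold sum_subtractf sum.distrib algebra_simps)
qed

definition quads :: "(nat \<Rightarrow> nat \<Rightarrow> nat \<Rightarrow> nat set) \<Rightarrow> (nat \<times> nat \<times> nat \<times> nat) set" where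
  "quads slot = {(a, b, c, d). (a, b, c) \<in> triples \<and> d \<in> slot a b c \<and> \<not> C a b d}"

lemma card_quads:
  assumes "\<And>a b c. (a, b, c) \<in> triples \<Longrightarrow> finite (slot a b c)"
  shows "int (card (quads slot)) + int (card {(a, b, c, d). (a, b, c) \<in> triples \<and> d \<in> slot a b c \<and> C a b d})
       = (\<Sum>(a, b, c) \<in> triples. int (card (slot a b c)))"
proof -
  let ?S = "{(a, b, c, d). (a, b, c) \<in> triples \<and> d \<in> slot a b c}"
  let ?Q = "{(a, b, c, d). (a, b, c) \<in> triples \<and> d \<in> slot a b c \<and> C a b d}"
  have eq: "?S = (\<lambda>((a, b, c), d). (a, b, c, d)) ` (Sigma triples (\<lambda>(a, b, c). slot a b c))"
    by force
  have finS: "finite ?S"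
    unfolding eq by (auto intro!: finite_SigmaI assms)
  have "card ?S = card (Sigma triples (\<lambda>(a, b, c). slot a b c))"
    unfolding eq by (rule card_image) (auto simp: inj_on_def)
  also have "\<dots> = (\<Sum>(a, b, c) \<in> triples. card (slot a b c))"
    by (subst card_SigmaI) (auto intro: assms simp: case_prod_unfold)
  finally have "int (card ?S) = (\<Sum>(a, b, c) \<in> triples. int (card (slot a b c)))"
    by (simp add: case_prod_unfold)
  moreover have "?S = quads slot \<union> ?Q" "quads slot \<inter> ?Q = {}"
    by (auto simp: quads_def)
  ultimately show ?thesis
    using finS card_Un_disjoint[of "quads slot" ?Q] by (simp add: finite_Un)
qed

text \<open>The totals over all points of a gap agree by \<open>gap_sums\<close>. The contributions
  of points on the line of the triple also agree, since exchanging \<open>d\<close> with the point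
  of the triple next to it moves it to the neighbouring gap. The difference counts the points off
  the line.\<close>

lemma card_quads_eq:
  assumes med_balanced
  shows "card (quads (\<lambda>a b c. {a<..<b})) = card (quads (\<lambda>a b c. {..<a}))"
    and "card (quads (\<lambda>a b c. {b<..<c})) = card (quads (\<lambda>a b c. {..<a}))"
    and "card (quads (\<lambda>a b c. {c<..<r})) = card (quads (\<lambda>a b c. {..<a}))"
proof -
  let ?Q = "\<lambda>slot. {(a, b, c, d). (a, b, c) \<in> triples \<and> d \<in> slot a b c \<and> C a b d}"
  \<comment> \<open>When all four points lie on one line, exchanging \<open>d\<close> with
    \<open>a\<close> or with \<open>b\<close> again yields a collinear triple and a point of its
    line.\<close>
  have swap1: "C d b c \<and> C d b a"
    and swap2: "C a d c \<and> C a d b"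
    if "C a b c" "C a b d" "a < r" "b < r" "c < r" "d < r" "a \<noteq> b" for a b c d
    using that C_line[of b a c d] C_line[of a b c d]
      C_perm(2)[of a b c] C_perm(2)[of a b d] C_perm(4)[of b c d] C_perm(5)[of a b d]
      C_perm(1)[of a c d] C_perm(1)[of a b d] by auto
  have "bij_betw (\<lambda>(a, b, c, d). (d, b, c, a)) (?Q (\<lambda>a b c. {a<..<b})) (?Q (\<lambda>a b c. {..<a}))"
    by (rule bij_betw_byWitness[where f' = "\<lambda>(a, b, c, d). (d, b, c, a)"])
      (clarsimp; fail | clarsimp simp: triples_def, frule (1) swap1; simp)+
  then have 1: "card (?Q (\<lambda>a b c. {a<..<b})) = card (?Q (\<lambda>a b c. {..<a}))"
    by (rule bij_betw_same_card)
  have "bij_betw (\<lambda>(a, b, c, d). (a, d, c, b)) (?Q (\<lambda>a b c. {b<..<c})) (?Q (\<lambda>a b c. {a<..<b}))"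
    by (rule bij_betw_byWitness[where f' = "\<lambda>(a, b, c, d). (a, d, c, b)"])
      (clarsimp; fail | clarsimp simp: triples_def, frule (1) swap2; simp)+
  then have 2: "card (?Q (\<lambda>a b c. {b<..<c})) = card (?Q (\<lambda>a b c. {..<a}))"
    by (rule trans[OF bij_betw_same_card 1])
  have "bij_betw (\<lambda>(a, b, c, d). (a, b, d, c)) (?Q (\<lambda>a b c. {c<..<r})) (?Q (\<lambda>a b c. {b<..<c}))"
    by (rule bij_betw_byWitness[where f' = "\<lambda>(a, b, c, d). (a, b, d, c)"])
      (auto simp: triples_def)
  then have 3: "card (?Q (\<lambda>a b c. {c<..<r})) = card (?Q (\<lambda>a b c. {..<a}))"
    by (rule trans[OF bij_betw_same_card 2])
  have gaps: "(\<Sum>(a, b, c) \<in> triples. int (card {a<..<b})) = (\<Sum>(a, b, c) \<in> triples. int b - int a - 1)"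
    "(\<Sum>(a, b, c) \<in> triples. int (card {b<..<c})) = (\<Sum>(a, b, c) \<in> triples. int c - int b - 1)"
    "(\<Sum>(a, b, c) \<in> triples. int (card {c<..<r})) = (\<Sum>(a, b, c) \<in> triples. int r - 1 - int c)"
    by (auto intro!: sum.cong simp: triples_def of_nat_diff)
  have slots: "(\<Sum>(a, b, c) \<in> triples. int (card {a<..<b})) = (\<Sum>(a, b, c) \<in> triples. int (card {..<a}))"
    "(\<Sum>(a, b, c) \<in> triples. int (card {b<..<c})) = (\<Sum>(a, b, c) \<in> triples. int (card {..<a}))"
    "(\<Sum>(a, b, c) \<in> triples. int (card {c<..<r})) = (\<Sum>(a, b, c) \<in> triples. int (card {..<a}))"
    unfolding card_lessThan gaps by (fact gap_sums[OF assms])+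
  show "card (quads (\<lambda>a b c. {a<..<b})) = card (quads (\<lambda>a b c. {..<a}))"
    "card (quads (\<lambda>a b c. {b<..<c})) = card (quads (\<lambda>a b c. {..<a}))"
    "card (quads (\<lambda>a b c. {c<..<r})) = card (quads (\<lambda>a b c. {..<a}))"
    using card_quads[of "\<lambda>a b c. {a<..<b}"] card_quads[of "\<lambda>a b c. {b<..<c}"]
      card_quads[of "\<lambda>a b c. {c<..<r}"] card_quads[of "\<lambda>a b c. {..<a}"] 1 2 3 slots
    by simp_all
qed


section \<open>Sequences with exactly one collinear triple\<close>

definition offs :: "(nat \<times> nat \<times> nat \<times> nat) set" where
  "offs = {(a, b, c, d). {a, b, c, d} \<subseteq> {..<r} \<and> distinct [a, b, c, d] \<and> C a b c \<and> \<not> C a b d}"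

text \<open>The four functions insert the off-line point \<open>d\<close> in first, second, third
  and last place. The images of \<open>offs\<close> are the four orbits that contain neither
  quadrangles nor collinear sequences.\<close>

definition placements :: "(nat \<times> nat \<times> nat \<times> nat \<Rightarrow> nat list) list" where
  "placements = [\<lambda>(a, b, c, d). [d, a, b, c], \<lambda>(a, b, c, d). [a, d, b, c],
     \<lambda>(a, b, c, d). [a, b, d, c], \<lambda>(a, b, c, d). [a, b, c, d]]"

text \<open>This predicate and the next depend only on the set of entries, so the classes of
  sequences defined by them are closed under rearrangement, as \<open>card_symmetric_seqs\<close>
  demands.\<close>

definition has_line :: "nat set \<Rightarrow> bool" where
  "has_line A \<longleftrightarrow> (\<exists>a\<in>A. \<exists>b\<in>A. \<exists>c\<in>A. distinct [a, b, c] \<and> C a b c)"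

definition all_line :: "nat set \<Rightarrow> bool" where
  "all_line A \<longleftrightarrow> (\<forall>a\<in>A. \<forall>b\<in>A. \<forall>c\<in>A. distinct [a, b, c] \<longrightarrow> C a b c)"

lemma has_line_four:
  assumes "distinct [w, x, y, z]"
  shows "has_line (set [w, x, y, z]) \<longleftrightarrow> C w x y \<or> C w x z \<or> C w y z \<or> C x y z"
    and "all_line (set [w, x, y, z]) \<longleftrightarrow> C w x y \<and> C w x z \<and> C w y z \<and> C x y z"
proof -
  note norm = C_perm[of w x y, symmetric] C_perm[of w x z, symmetric]
    C_perm[of w y z, symmetric] C_perm[of x y z, symmetric]
  show "has_line (set [w, x, y, z]) \<longleftrightarrow> C w x y \<or> C w x z \<or> C w y z \<or> C x y z"
    unfolding has_line_def using assms by (simp add: norm) blast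
  show "all_line (set [w, x, y, z]) \<longleftrightarrow> C w x y \<and> C w x z \<and> C w y z \<and> C x y z"
    unfolding all_line_def using assms by (simp add: norm) blast
qed

lemma four_collinear:
  assumes "distinct [w, x, y, z]" "{w, x, y, z} \<subseteq> {..<r}" "C w x y" "C w x z"
  shows "C w y z" "C x y z"
  using assms C_line[of w x y z] C_line[of x w y z] C_swap12[of w x] by auto

text \<open>Two different triples among four points share two points, so if both are collinear, all
  four points are on one line. A mixed sequence thus has a unique collinear triple, and the place of
  the remaining entry determines the placement.\<close>

lemma mixed_seqs:
  "{s \<in> distinct_seqs r 4. has_line (set s) \<and> \<not> all_line (set s)} = (\<Union>p \<in> set placements. p ` offs)"
  (is "?M = _")
proof (intro equalityI subsetI)
  fix s assume s: "s \<in> ?M"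
  then obtain w x y z where [simp]: "s = [w, x, y, z]"
    by (auto simp: distinct_seqs_def numeral_eq_Suc length_Suc_conv)
  have d: "distinct [w, x, y, z]" "{w, x, y, z} \<subseteq> {..<r}"
    using s by (auto simp: distinct_seqs_def)
  have h: "C w x y \<or> C w x z \<or> C w y z \<or> C x y z" "\<not> (C w x y \<and> C w x z \<and> C w y z \<and> C x y z)"
    using s has_line_four[OF d(1)] by auto
  note four = four_collinear[OF d]
  consider "C w x y" "\<not> C w x z" | "C w x z" "\<not> C w x y" | "C w y z" "\<not> C w x y" | "C x y z" "\<not> C w x y"
    using h four by blast
  then show "s \<in> (\<Union>p \<in> set placements. p ` offs)"
  proof cases
    case 1
    then have "(w, x, y, z) \<in> offs" using d by (auto simp: offs_def)
    then show ?thesis by (force simp: placements_def)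
  next
    case 2
    then have "(w, x, z, y) \<in> offs" using d by (auto simp: offs_def)
    then show ?thesis by (force simp: placements_def)
  next
    case 3
    then have "(w, y, z, x) \<in> offs" using d C_perm(1)[of w x y] by (auto simp: offs_def)
    then show ?thesis by (force simp: placements_def)
  next
    case 4
    then have "(x, y, z, w) \<in> offs" using d C_perm(3)[of w x y] by (auto simp: offs_def)
    then show ?thesis by (force simp: placements_def)
  qed
next
  fix s assume "s \<in> (\<Union>p \<in> set placements. p ` offs)"
  then obtain p a b c d where p: "p \<in> set placements" and o: "(a, b, c, d) \<in> offs" and s: "s = p (a, b, c, d)"
    by auto
  have "set s = {a, b, c, d}" "distinct s" "length s = 4"
    using p o by (auto simp: s placements_def offs_def)
  moreover have "has_line {a, b, c, d}" "\<not> all_line {a, b, c, d}" "{a, b, c, d} \<subseteq> {..<r}"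
    using o unfolding has_line_def all_line_def by (auto simp: offs_def)
  ultimately show "s \<in> ?M"
    by (auto simp: distinct_seqs_def)
qed

lemma finite_offs: "finite offs"
  by (rule finite_subset[of _ "{..<r} \<times> {..<r} \<times> {..<r} \<times> {..<r}"]) (auto simp: offs_def)

text \<open>A placed sequence is increasing iff \<open>a < b < c\<close> and \<open>d\<close> lies
  in the gap that the placement prescribes; \<open>card_quads_eq\<close> compares the four
  gaps.\<close>

lemma placement_sorted:
  assumes med_balanced "p \<in> set placements"
  shows "card {s \<in> p ` offs. sorted_wrt (<) s} = card (quads (\<lambda>a b c. {..<a}))"
proof -
  have eq: "{s \<in> (\<lambda>(a, b, c, d). [d, a, b, c]) ` offs. sorted_wrt (<) s}
      = (\<lambda>(a, b, c, d). [d, a, b, c]) ` quads (\<lambda>a b c. {..<a})"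
    "{s \<in> (\<lambda>(a, b, c, d). [a, d, b, c]) ` offs. sorted_wrt (<) s}
      = (\<lambda>(a, b, c, d). [a, d, b, c]) ` quads (\<lambda>a b c. {a<..<b})"
    "{s \<in> (\<lambda>(a, b, c, d). [a, b, d, c]) ` offs. sorted_wrt (<) s}
      = (\<lambda>(a, b, c, d). [a, b, d, c]) ` quads (\<lambda>a b c. {b<..<c})"
    "{s \<in> (\<lambda>(a, b, c, d). [a, b, c, d]) ` offs. sorted_wrt (<) s}
      = (\<lambda>(a, b, c, d). [a, b, c, d]) ` quads (\<lambda>a b c. {c<..<r})"
    by (auto simp: quads_def offs_def triples_def image_def; force)+
  have inj: "inj_on (\<lambda>(a, b, c, d). [d, a, b, c]) A" "inj_on (\<lambda>(a, b, c, d). [a, d, b, c]) A"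
    "inj_on (\<lambda>(a, b, c, d). [a, b, d, c]) A" "inj_on (\<lambda>(a, b, c, d). [a, b, c, d]) A"
    for A :: "(nat \<times> nat \<times> nat \<times> nat) set"
    by (auto simp: inj_on_def)
  show ?thesis
    using assms(2) by (auto simp: placements_def eq card_image inj card_quads_eq[OF assms(1)])
qed

lemma offs_excl:
  assumes "(a, b, c, d) \<in> offs"
  shows "\<not> C a c d" "\<not> C b c d"
  using assms C_line[of a c b d] C_line[of b c a d] C_perm(1)[of a b c] C_perm(3)[of a b c]
    C_perm(2)[of a b d] by (auto simp: offs_def)

text \<open>The union of the four classes is closed under rearrangement, so one in 24 of its members
  is increasing. The classes have equal sizes and, by \<open>placement_sorted\<close>, equally many
  increasing members, so the same ratio holds in each.\<close>

lemma placement_card: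
  assumes "med_balanced" "p \<in> set placements"
  shows "card (p ` offs) = 24 * card {s \<in> p ` offs. sorted_wrt (<) s}"
proof -
  let ?M = "{s \<in> distinct_seqs r 4. has_line (set s) \<and> \<not> all_line (set s)}"
  let ?p1 = "(\<lambda>(a, b, c, d). [d, a, b, c]) ` offs" and ?p2 = "(\<lambda>(a, b, c, d). [a, d, b, c]) ` offs"
    and ?p3 = "(\<lambda>(a, b, c, d). [a, b, d, c]) ` offs" and ?p4 = "(\<lambda>(a, b, c, d). [a, b, c, d]) ` offs"
  have M: "?M = ?p1 \<union> (?p2 \<union> (?p3 \<union> ?p4))"
    unfolding mixed_seqs by (simp add: placements_def)
  \<comment> \<open>The places of the collinear entries tell the four images apart, so these are
    disjoint.\<close>
  have 1: "\<not> C (s ! 0) (s ! 1) (s ! 2) \<and> \<not> C (s ! 0) (s ! 1) (s ! 3) \<and> \<not> C (s ! 0) (s ! 2) (s ! 3)"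
    if s: "s \<in> ?p1" for s
  proof -
    from s obtain a b c d where o: "(a, b, c, d) \<in> offs" "s = [d, a, b, c]" by auto
    then show ?thesis
      using offs_excl[OF o(1)] C_perm(4)[of a b d] C_perm(4)[of a c d] C_perm(4)[of b c d]
      by (simp add: offs_def)
  qed
  have 2: "\<not> C (s ! 0) (s ! 1) (s ! 2) \<and> \<not> C (s ! 0) (s ! 1) (s ! 3) \<and> C (s ! 0) (s ! 2) (s ! 3)"
    if s: "s \<in> ?p2" for s
  proof -
    from s obtain a b c d where o: "(a, b, c, d) \<in> offs" "s = [a, d, b, c]" by auto
    then show ?thesis
      using offs_excl[OF o(1)] C_perm(1)[of a b d] C_perm(1)[of a c d] by (simp add: offs_def)
  qed
  have 3: "\<not> C (s ! 0) (s ! 1) (s ! 2) \<and> C (s ! 0) (s ! 1) (s ! 3)" if "s \<in> ?p3" for s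
    using that by (auto simp: offs_def)
  have 4: "C (s ! 0) (s ! 1) (s ! 2)" if "s \<in> ?p4" for s
    using that by (auto simp: offs_def)
  have disj: "?p1 \<inter> (?p2 \<union> (?p3 \<union> ?p4)) = {}" "?p2 \<inter> (?p3 \<union> ?p4) = {}" "?p3 \<inter> ?p4 = {}"
    using 1 2 3 4 by blast+
  have "inj_on p offs" if "p \<in> set placements" for p
    using that by (auto simp: placements_def inj_on_def)
  then have card_p: "card (p ` offs) = card offs" if "p \<in> set placements" for p
    using that by (simp add: card_image)
  have "card ?M = 4 * card offs"
    unfolding M using card_p disj
    by (simp add: placements_def card_Un_disjoint finite_offs)
  moreover have "card ?M = fact 4 * card {s \<in> ?M. sorted_wrt (<) s}"
    by (rule card_symmetric_seqs) auto
  moreover have "card {s \<in> ?M. sorted_wrt (<) s} = 4 * card (quads (\<lambda>a b c. {..<a}))"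
    unfolding M using placement_sorted[OF assms(1)]
    by (simp add: placements_def card_filter_Un disj finite_offs del: Un_iff)
  ultimately show ?thesis
    using card_p[OF assms(2)] placement_sorted[OF assms] by (simp add: fact_numeral)
qed

text \<open>Being a quadrangle is a property of the set of entries, so here the ratio holds in any
  ordering.\<close>

lemma frame_card:
  "card {s \<in> distinct_seqs r 4. \<not> has_line (set s)}
     = 24 * card {s \<in> {s \<in> distinct_seqs r 4. \<not> has_line (set s)}. sorted_wrt (<) s}"
proof -
  have "card {s \<in> distinct_seqs r 4. \<not> has_line (set s)}
     = fact 4 * card {s \<in> {s \<in> distinct_seqs r 4. \<not> has_line (set s)}. sorted_wrt (<) s}"
    by (rule card_symmetric_seqs) auto
  then show ?thesis by (simp add: fact_numeral)
qed

text \<open>The first two entries span a line, and each of the last two is one of its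
  \<open>m\<close> further points. This is only a bound because it lets the last two
  coincide.\<close>

lemma card_all_line: "card {s \<in> distinct_seqs r 4. all_line (set s)} \<le> r * (r - 1) * m\<^sup>2"
proof -
  let ?S = "\<lambda>a b. {c. c < r \<and> c \<noteq> a \<and> c \<noteq> b \<and> C a b c}"
  let ?P = "SIGMA a:{..<r}. {..<r} - {a}"
  let ?T = "SIGMA (a, b):?P. ?S a b \<times> ?S a b"
  have "{s \<in> distinct_seqs r 4. all_line (set s)} \<subseteq> (\<lambda>((a, b), c, d). [a, b, c, d]) ` ?T"
  proof
    fix s assume s: "s \<in> {s \<in> distinct_seqs r 4. all_line (set s)}"
    then obtain w x y z where [simp]: "s = [w, x, y, z]"
      by (auto simp: distinct_seqs_def numeral_eq_Suc length_Suc_conv)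
    have d: "distinct [w, x, y, z]" using s by (auto simp: distinct_seqs_def)
    have "((w, x), y, z) \<in> ?T"
      using s has_line_four(2)[OF d] by (auto simp: distinct_seqs_def)
    then show "s \<in> (\<lambda>((a, b), c, d). [a, b, c, d]) ` ?T" by force
  qed
  moreover have finT: "finite ?T" by (intro finite_SigmaI) auto
  ultimately have "card {s \<in> distinct_seqs r 4. all_line (set s)} \<le> card ?T"
    by (meson card_image_le card_mono finite_imageI le_trans)
  also have "card ?T = (\<Sum>(a, b)\<in>?P. card (?S a b \<times> ?S a b))"
    by (subst card_SigmaI) (auto simp: case_prod_unfold)
  also have "\<dots> = (\<Sum>(a, b)\<in>?P. m\<^sup>2)"
    using card_line by (intro sum.cong) (force simp: card_cartesian_product power2_eq_square)+
  also have "\<dots> = r * (r - 1) * m\<^sup>2"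
    by (simp add: case_prod_unfold)
  finally show ?thesis .
qed

end

section \<open>Coordinates for the projective plane\<close>

text \<open>Normal forms of homogeneous coordinates, with first nonzero coordinate 1: affine points,
  the point at infinity of the lines of a given slope, and that of the vertical lines.\<close>

datatype 'a pt = Aff 'a 'a | Slope 'a | Vert

lemma UNIV_pt: "UNIV = case_prod Aff ` UNIV \<union> range Slope \<union> {Vert}"
proof -
  have "p \<in> case_prod Aff ` UNIV \<union> range Slope \<union> {Vert}" for p :: "'a pt"
    by (cases p) auto
  then show ?thesis by blast
qed

instance pt :: (finite) finite
  by standard (simp add: UNIV_pt)

lemma card_pt: "CARD('a::finite pt) = CARD('a)\<^sup>2 + CARD('a) + 1"
proof -
  have "card (case_prod Aff ` (UNIV :: ('a \<times> 'a) set)) = CARD('a)\<^sup>2"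
    by (subst card_image) (auto simp: inj_on_def power2_eq_square)
  moreover have "card (range (Slope :: 'a \<Rightarrow> _)) = CARD('a)"
    by (rule card_image) (auto simp: inj_on_def)
  ultimately show ?thesis
    unfolding UNIV_pt by (subst card_Un_disjoint, simp, simp, force)+ simp
qed

definition det3 :: "'a::comm_ring_1 ^ 3 \<Rightarrow> 'a ^ 3 \<Rightarrow> 'a ^ 3 \<Rightarrow> 'a" where
  "det3 u v w = det (vector [u, v, w] :: 'a ^ 3 ^ 3)"

lemma det3_expand:
  "det3 u v w = u$1 * v$2 * w$3 + u$2 * v$3 * w$1 + u$3 * v$1 * w$2
     - u$1 * v$3 * w$2 - u$2 * v$1 * w$3 - u$3 * v$2 * w$1"
  by (simp add: det3_def det_3 vector_3)

lemma det3_swap: "det3 v u w = - det3 u v w" "det3 u w v = - det3 u v w"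
  by (simp_all add: det3_expand algebra_simps)

fun hom :: "'a::comm_ring_1 pt \<Rightarrow> 'a ^ 3" where
  "hom (Aff x y) = vector [1, x, y]"
| "hom (Slope m) = vector [0, 1, m]"
| "hom Vert = vector [0, 0, 1]"

definition col :: "'a::comm_ring_1 pt \<Rightarrow> 'a pt \<Rightarrow> 'a pt \<Rightarrow> bool" where
  "col p q s \<longleftrightarrow> det3 (hom p) (hom q) (hom s) = 0"

lemma col_swap12: "col p q s \<Longrightarrow> col q p s"
  and col_swap23: "col p q s \<Longrightarrow> col p s q"
  using det3_swap(1)[of "hom q" "hom p" "hom s"] det3_swap(2)[of "hom p" "hom s" "hom q"]
  by (simp_all add: col_def)

text \<open>A label for the line from the first point to the second among the q + 1 lines through
  the first: its slope at an affine point, its intercept at \<open>Slope m\<close>, its abscissa at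
  \<open>Vert\<close>. \<open>None\<close> labels the vertical line in the first case and the line
  at infinity in the other two. The value at two equal points is arbitrary.\<close>

fun dir :: "'a::field pt \<Rightarrow> 'a pt \<Rightarrow> 'a option" where
  "dir (Aff x y) (Aff x' y') = (if x' = x then None else Some ((y' - y) / (x' - x)))"
| "dir (Aff x y) (Slope m) = Some m"
| "dir (Aff x y) Vert = None"
| "dir (Slope m) (Aff x y) = Some (y - m * x)"
| "dir (Slope m) _ = None"
| "dir Vert (Aff x y) = Some x"
| "dir Vert _ = None"

lemma col_iff_dir:
  assumes "p \<noteq> s" "p \<noteq> t"
  shows "col p s t \<longleftrightarrow> dir p s = dir p t"
proof -
  have aff: "det3 (hom (Aff x y)) (hom (Aff x' y')) (hom (Aff x'' y''))
      = (x' - x) * (y'' - y) - (x'' - x) * (y' - y)" for x y x' y' x'' y'' :: 'a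
    by (simp add: det3_expand algebra_simps)
  have aff_iff: "(x' - x) * (y'' - y) - (x'' - x) * (y' - y) = 0
      \<longleftrightarrow> dir (Aff x y) (Aff x' y') = dir (Aff x y) (Aff x'' y'')"
    if "Aff x y \<noteq> Aff x' y'" "Aff x y \<noteq> Aff x'' y''" for x y x' y' x'' y'' :: 'a
    using that by (cases "x' = x"; cases "x'' = x") (auto simp: frac_eq_eq mult.commute)
  show ?thesis
    using assms unfolding col_def
    by (cases p; cases s; cases t; simp only: aff aff_iff)
      (auto simp: det3_expand field_simps)
qed

text \<open>Each line through a point is parametrised by one field element, possibly with one extra
  point at infinity. The predicate \<open>P\<close> allows the same formulas to give the size of a
  line and the number of its points before or after a given one.\<close>

lemma card_dir_class:
  fixes x y m b :: "'a::{field,finite}" and P :: "'a pt \<Rightarrow> bool"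
  shows "card {p. p \<noteq> Aff x y \<and> dir (Aff x y) p = Some m \<and> P p}
      = card {x'. x' \<noteq> x \<and> P (Aff x' (y + m * (x' - x)))} + of_bool (P (Slope m))" (is ?th1)
    and "card {p. p \<noteq> Aff x y \<and> dir (Aff x y) p = None \<and> P p}
      = card {y'. y' \<noteq> y \<and> P (Aff x y')} + of_bool (P Vert)" (is ?th2)
    and "card {p. p \<noteq> Slope m \<and> dir (Slope m) p = Some b \<and> P p} = card {x. P (Aff x (m * x + b))}" (is ?th3)
    and "card {p. p \<noteq> Slope m \<and> dir (Slope m) p = None \<and> P p}
      = card {m'. m' \<noteq> m \<and> P (Slope m')} + of_bool (P Vert)" (is ?th4)
    and "card {p. p \<noteq> Vert \<and> dir Vert p = Some x \<and> P p} = card {y. P (Aff x y)}" (is ?th5)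
    and "card {p. p \<noteq> Vert \<and> dir Vert p = None \<and> P p} = card {m. P (Slope m)}" (is ?th6)
proof -
  have un: "card (f ` A \<union> {p. p = s \<and> P p}) = card A + of_bool (P s)"
    if "inj_on f A" "s \<notin> f ` A" for f :: "'a \<Rightarrow> 'a pt" and A s
  proof (cases "P s")
    case True
    then have e: "{p. p = s \<and> P p} = {s}" by auto
    show ?thesis unfolding e using that True by (simp add: card_image)
  next
    case False
    then have e: "{p. p = s \<and> P p} = {}" by auto
    show ?thesis unfolding e using that False by (simp add: card_image)
  qed
  have "{p. p \<noteq> Aff x y \<and> dir (Aff x y) p = Some m \<and> P p}
      = (\<lambda>x'. Aff x' (y + m * (x' - x))) ` {x'. x' \<noteq> x \<and> P (Aff x' (y + m * (x' - x)))} \<union> {p. p = Slope m \<and> P p}"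
    (is "?L = ?R")
  proof (intro set_eqI)
    fix p show "p \<in> ?L \<longleftrightarrow> p \<in> ?R"
    proof (cases p)
      case (Aff x' y')
      have "dir (Aff x y) p = Some m \<longleftrightarrow> x' \<noteq> x \<and> y' = y + m * (x' - x)"
        by (auto simp: Aff field_simps)
      then show ?thesis unfolding Aff by (auto simp: image_iff)
    qed auto
  qed
  then show ?th1 by (simp only:) (subst un; auto simp: inj_on_def)
  have "{p. p \<noteq> Aff x y \<and> dir (Aff x y) p = None \<and> P p}
      = Aff x ` {y'. y' \<noteq> y \<and> P (Aff x y')} \<union> {p. p = Vert \<and> P p}" (is "?L = ?R")
  proof (intro set_eqI)
    fix p show "p \<in> ?L \<longleftrightarrow> p \<in> ?R" by (cases p) auto
  qed
  then show ?th2 by (simp only:) (subst un; auto simp: inj_on_def)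
  have "{p. p \<noteq> Slope m \<and> dir (Slope m) p = Some b \<and> P p}
      = (\<lambda>x. Aff x (m * x + b)) ` {x. P (Aff x (m * x + b))}" (is "?L = ?R")
  proof (intro set_eqI)
    fix p show "p \<in> ?L \<longleftrightarrow> p \<in> ?R" by (cases p) (auto simp: image_iff algebra_simps)
  qed
  then show ?th3 by (simp only:) (subst card_image; auto simp: inj_on_def)
  have "{p. p \<noteq> Slope m \<and> dir (Slope m) p = None \<and> P p}
      = Slope ` {m'. m' \<noteq> m \<and> P (Slope m')} \<union> {p. p = Vert \<and> P p}" (is "?L = ?R")
  proof (intro set_eqI)
    fix p show "p \<in> ?L \<longleftrightarrow> p \<in> ?R" by (cases p) auto
  qed
  then show ?th4 by (simp only:) (subst un; auto simp: inj_on_def)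
  have "{p. p \<noteq> Vert \<and> dir Vert p = Some x \<and> P p} = Aff x ` {y. P (Aff x y)}" (is "?L = ?R")
  proof (intro set_eqI)
    fix p show "p \<in> ?L \<longleftrightarrow> p \<in> ?R" by (cases p) auto
  qed
  then show ?th5 by (simp only:) (subst card_image; auto simp: inj_on_def)
  have "{p. p \<noteq> Vert \<and> dir Vert p = None \<and> P p} = Slope ` {m. P (Slope m)}" (is "?L = ?R")
  proof (intro set_eqI)
    fix p show "p \<in> ?L \<longleftrightarrow> p \<in> ?R" by (cases p) auto
  qed
  then show ?th6 by (simp only:) (subst card_image; auto simp: inj_on_def)
qed

lemma card_line_pt:
  fixes p s :: "'a::{field,finite} pt"
  assumes "p \<noteq> s"
  shows "card {t. t \<noteq> p \<and> t \<noteq> s \<and> col p s t} = CARD('a) - 1"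
proof -
  have pos: "CARD('a) > 0" by (simp add: card_gt_0_iff)
  have ne: "card {x'. x' \<noteq> x} = CARD('a) - 1" for x :: 'a
  proof -
    have "{x'. x' \<noteq> x} = UNIV - {x}" by auto
    then show ?thesis by simp
  qed
  have "card {t. t \<noteq> p \<and> dir p t = d} = CARD('a)" for d
    using pos by (cases p; cases d) (simp_all add: ne card_dir_class[where P = "\<lambda>_. True", simplified])
  moreover have "{t. t \<noteq> p \<and> t \<noteq> s \<and> col p s t} = {t. t \<noteq> p \<and> dir p t = dir p s} - {s}"
    using assms by (auto simp: col_iff_dir)
  ultimately show ?thesis
    using assms by simp
qed

lemma col_line:
  fixes p s t u :: "'a::field pt"
  assumes "p \<noteq> s" "col p s t" "col p s u"
  shows "col p t u"
proof -
  have "col p p v" "col p v p" for v :: "'a pt"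
    by (simp_all add: col_def det3_expand algebra_simps)
  then show ?thesis
    using assms col_iff_dir[of p s t] col_iff_dir[of p s u] col_iff_dir[of p t u]
    by (cases "t = p"; cases "u = p") auto
qed

section \<open>The ordering of the points\<close>

text \<open>Two second coordinates differ by less than \<open>2 * n\<close>, so they cannot outweigh
  a difference in the first.\<close>

lemma lex_less_iff:
  fixes a b c d n :: int
  assumes "\<bar>b\<bar> < n" "\<bar>d\<bar> < n"
  shows "2 * n * a + b < 2 * n * c + d \<longleftrightarrow> a < c \<or> a = c \<and> b < d"
proof (cases "a = c")
  case False
  have n: "n > 0" using assms by linarith
  have *: "2 * n * x + y < 2 * n * z + w" if "x < z" "\<bar>y\<bar> < n" "\<bar>w\<bar> < n" for x y z w
  proof -
    have "2 * n * (x + 1) \<le> 2 * n * z"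
      using that n by (intro mult_left_mono) auto
    then show ?thesis using that by (simp add: algebra_simps)
  qed
  then show ?thesis
    using *[of a c b d] *[of c a d b] assms False by linarith
qed simp

text \<open>An ordering of the field given by integers symmetric about 0, so that reversal is an
  involution \<open>cj\<close> of the field. The value 0 occurs exactly when the field has odd
  order, as \<open>cj\<close> fixes no other element.\<close>

locale centered_order =
  fixes k :: "'a::{field,finite} \<Rightarrow> int" and n :: int
  assumes n_eq: "n = int CARD('a)"
    and inj_k: "inj k"
    and k_bound: "\<bar>k x\<bar> < n"
    and k_symmetric: "\<exists>y. k y = - k x"
begin

definition cj :: "'a \<Rightarrow> 'a" where "cj x = (SOME y. k y = - k x)"

lemma k_cj [simp]: "k (cj x) = - k x"
  unfolding cj_def using k_symmetric by (rule someI_ex)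

lemma k_eq_iff [simp]: "k x = k y \<longleftrightarrow> x = y"
  using inj_k by (auto simp: inj_on_def)

lemma cj_cj [simp]: "cj (cj x) = x"
  using k_eq_iff[of "cj (cj x)" x] by (simp del: k_eq_iff)

lemma cj_fixed: "k x = 0 \<Longrightarrow> cj x = x"
  using k_eq_iff[of "cj x" x] by (simp del: k_eq_iff)

lemma bij_cj: "bij cj"
  by (rule o_bij[of cj cj]) auto

lemma n_pos: "n \<ge> 1"
  using zero_less_card_finite[where 'a='a] n_eq by linarith

definition lx :: "'a \<Rightarrow> 'a \<Rightarrow> int" where "lx x y = 2 * n * k x + k y"

lemma lx_less_iff: "lx x y < lx x' y' \<longleftrightarrow> k x < k x' \<or> x = x' \<and> k y < k y'"
  unfolding lx_def using lex_less_iff[OF k_bound k_bound] by simp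

lemma lx_pos_iff: "0 < lx x y \<longleftrightarrow> 0 < k x \<or> k x = 0 \<and> 0 < k y"
  unfolding lx_def using lex_less_iff[of 0 n "k y" 0 "k x"] k_bound[of y] n_pos by auto

lemma lx_neg_iff: "lx x y < 0 \<longleftrightarrow> k x < 0 \<or> k x = 0 \<and> k y < 0"
  unfolding lx_def using lex_less_iff[of "k y" n 0 "k x" 0] k_bound[of y] n_pos by auto

lemma lx_zero_iff: "lx x y = 0 \<longleftrightarrow> k x = 0 \<and> k y = 0"
  using lx_pos_iff[of x y] lx_neg_iff[of x y] by linarith

lemma lx_cj: "lx (cj x) (cj y) = - lx x y"
  by (simp add: lx_def)

lemma lx_bound: "\<bar>lx x y\<bar> < 3 * n\<^sup>2"
proof -
  have "\<bar>lx x y\<bar> \<le> 2 * n * \<bar>k x\<bar> + \<bar>k y\<bar>"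
    unfolding lx_def using n_pos abs_triangle_ineq[of "2 * n * k x" "k y"] by (simp add: abs_mult)
  also have "\<dots> \<le> 2 * n * n + \<bar>k y\<bar>"
    using k_bound[of x] n_pos by (intro add_right_mono mult_left_mono) auto
  also have "\<dots> < 2 * n * n + n * n"
    using k_bound[of y] n_pos mult_left_mono[of 1 n n] by linarith
  finally show ?thesis by (simp add: power2_eq_square)
qed

text \<open>The factor puts the noncentral directions beyond all affine points: \<open>key\<close>
  takes absolute values below 6 n^2 on affine points by \<open>lx_bound\<close>, and at least 8 n^2
  on these directions.\<close>

definition sl :: "'a \<Rightarrow> int" where "sl m = n\<^sup>2 * k m"

lemma sl_simps:
  "sl m < sl m' \<longleftrightarrow> k m < k m'" "0 < sl m \<longleftrightarrow> 0 < k m" "sl m < 0 \<longleftrightarrow> k m < 0" "sl m = 0 \<longleftrightarrow> k m = 0"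
  "sl (cj m) = - sl m"
  using n_pos by (auto simp: sl_def zero_less_mult_iff mult_less_0_iff)

lemma sl_bound: "k m < 0 \<Longrightarrow> sl m \<le> - n\<^sup>2" "0 < k m \<Longrightarrow> n\<^sup>2 \<le> sl m"
  using mult_left_mono[of "k m" "-1" "n\<^sup>2"] mult_left_mono[of 1 "k m" "n\<^sup>2"] by (auto simp: sl_def)

text \<open>The affine points come in lexicographic order and the points on the line at infinity at the
  two ends, except that \<open>Vert\<close> goes to the centre. If \<open>k x = 0\<close> for some \<open>x\<close>, that is if the field has
  odd order, then \<open>Aff x x\<close>, \<open>Vert\<close>, \<open>Slope x\<close> are the three central points, in this order.\<close>

fun key :: "'a pt \<Rightarrow> int" where
  "key (Aff x y) = (if lx x y = 0 then -1 else 2 * lx x y)"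
| "key (Slope m) = (if sl m = 0 then 1 else 8 * sl m)"
| "key Vert = 0"

text \<open>The reversal of the ordering. It need not preserve collinearity; what matters is that it
  preserves the number of triples with a given median, see \<open>mids_star\<close>.\<close>

fun star :: "'a pt \<Rightarrow> 'a pt" where
  "star (Aff x y) = (if lx x y = 0 then Slope x else Aff (cj x) (cj y))"
| "star (Slope m) = (if sl m = 0 then Aff m m else Slope (cj m))"
| "star Vert = Vert"

lemma key_star: "key (star p) = - key p"
  by (cases p) (auto simp: lx_cj sl_simps lx_zero_iff)

lemma key_Aff_less_iff:
  "key (Aff x y) < key (Aff x' y') \<longleftrightarrow> k x < k x' \<or> x = x' \<and> k y < k y'"
  unfolding lx_less_iff[symmetric] by auto

lemma key_Aff_pos_iff: "0 < key (Aff x y) \<longleftrightarrow> 0 < k x \<or> k x = 0 \<and> 0 < k y"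
  unfolding lx_pos_iff[symmetric] by auto

lemma key_Aff_neq: "key (Aff x y) \<noteq> 0" "key (Aff x y) \<noteq> 1"
  by (auto dest: arg_cong[of _ _ even])

lemma key_Slope_pos_iff: "0 < key (Slope m) \<longleftrightarrow> 0 \<le> k m"
  using sl_simps(2-4)[of m] by auto

lemma key_Slope_less_Aff:
  "key (Slope m) < key (Aff x y) \<longleftrightarrow> k m < 0 \<or> k m = 0 \<and> 0 < key (Aff x y)"
proof -
  have "1 \<le> n\<^sup>2" using n_pos one_le_power[of n 2] by linarith
  then show ?thesis
    using sl_bound[of m] lx_bound[of x y] sl_simps(2-4)[of m]
    by (cases "k m" "0 :: int" rule: linorder_cases) auto
qed

lemma key_Slope_less_iff: "key (Slope m) < key (Slope m') \<longleftrightarrow> k m < k m'"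
  unfolding sl_simps(1)[symmetric] by auto

lemma key_Slope_neq: "key (Slope m) \<noteq> 0"
  by auto

lemma key_Slope_neq_Aff: "key (Slope m) \<noteq> key (Aff x y)"
proof -
  have "1 \<le> n\<^sup>2" using n_pos one_le_power[of n 2] by linarith
  then show ?thesis
    using sl_bound[of m] lx_bound[of x y] sl_simps(2-4)[of m] key_Aff_neq[of x y]
    by (cases "k m" "0 :: int" rule: linorder_cases) auto
qed

declare key.simps(1,2) [simp del]

lemma inj_key: "inj key"
proof (rule injI)
  fix p s assume e: "key p = key s"
  show "p = s"
  proof (cases p; cases s)
    fix x y x' y' assume "p = Aff x y" "s = Aff x' y'"
    then show ?thesis
      using e key_Aff_less_iff[of x y x' y'] key_Aff_less_iff[of x' y' x y]
      by (metis k_eq_iff less_irrefl linorder_less_linear)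
  next
    fix m m' assume "p = Slope m" "s = Slope m'"
    then show ?thesis
      using e key_Slope_less_iff[of m m'] key_Slope_less_iff[of m' m]
      by (metis k_eq_iff less_irrefl linorder_less_linear)
  qed (use e key_Slope_neq_Aff key_Slope_neq key_Aff_neq in \<open>auto dest: sym\<close>)
qed

lemma key_eq_iff [simp]: "key p = key s \<longleftrightarrow> p = s"
  using inj_key by (auto simp: inj_on_def)

lemma star_star [simp]: "star (star p) = p"
  using key_eq_iff[of "star (star p)" p] by (simp add: key_star del: key_eq_iff)

section \<open>Counting collinear triples by their median\<close>

definition lt :: "'a \<Rightarrow> nat" where "lt x = card {x'. k x' < k x}"
definition gt :: "'a \<Rightarrow> nat" where "gt x = card {x'. k x < k x'}"

lemma lt_cj: "lt (cj x) = gt x"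
  and gt_cj: "gt (cj x) = lt x"
proof -
  have img: "{x'. k x' < k (cj y)} = cj ` {x'. k y < k x'}" for y
  proof (intro equalityI subsetI)
    fix z assume "z \<in> {x'. k x' < k (cj y)}"
    then have "k y < k (cj z)" by simp
    then show "z \<in> cj ` {x'. k y < k x'}"
      by (metis cj_cj image_eqI mem_Collect_eq)
  qed auto
  have *: "lt (cj y) = gt y" for y
    unfolding lt_def gt_def img by (rule card_image) (metis bij_cj bij_is_inj inj_on_subset subset_UNIV)
  show "lt (cj x) = gt x" by (rule *)
  show "gt (cj x) = lt x" using *[of "cj x"] by simp
qed

definition before :: "'a pt \<Rightarrow> 'a option \<Rightarrow> nat" where
  "before p d = card {s. s \<noteq> p \<and> dir p s = d \<and> key s < key p}"

definition after :: "'a pt \<Rightarrow> 'a option \<Rightarrow> nat" where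
  "after p d = card {s. s \<noteq> p \<and> dir p s = d \<and> key p < key s}"

definition mids :: "'a pt \<Rightarrow> nat" where
  "mids p = card {(s, t). key s < key p \<and> key p < key t \<and> col s p t}"

text \<open>A collinear triple with median \<open>p\<close> consists of a line through
  \<open>p\<close>, a point of it before \<open>p\<close> and a point of it after
  \<open>p\<close>.\<close>

lemma mids_eq: "mids p = (\<Sum>m\<in>UNIV. before p (Some m) * after p (Some m)) + before p None * after p None"
proof -
  let ?B = "\<lambda>d. {s. s \<noteq> p \<and> dir p s = d \<and> key s < key p}"
  let ?A = "\<lambda>d. {s. s \<noteq> p \<and> dir p s = d \<and> key p < key s}"
  have "{(s, t). key s < key p \<and> key p < key t \<and> col s p t} = (\<Union>d\<in>UNIV. ?B d \<times> ?A d)"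
  proof (intro set_eqI, clarsimp)
    fix s t
    have "col s p t \<longleftrightarrow> col p s t" using col_swap12 by blast
    moreover have "col p s t \<longleftrightarrow> dir p s = dir p t" if "key s < key p" "key p < key t"
      using that by (intro col_iff_dir) auto
    ultimately show "(key s < key p \<and> key p < key t \<and> col s p t) \<longleftrightarrow>
        s \<noteq> p \<and> key s < key p \<and> t \<noteq> p \<and> dir p t = dir p s \<and> key p < key t"
      by auto
  qed
  then have "mids p = (\<Sum>d\<in>UNIV. card (?B d \<times> ?A d))"
    unfolding mids_def by (simp only:) (rule card_UN_disjoint; auto)
  also have "\<dots> = (\<Sum>d\<in>UNIV. before p d * after p d)"
    by (simp add: before_def after_def card_cartesian_product)
  also have "\<dots> = before p None * after p None + (\<Sum>m\<in>UNIV. before p (Some m) * after p (Some m))"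
    unfolding UNIV_option_conv by (subst sum.insert) (auto simp: sum.reindex)
  finally show ?thesis by simp
qed

text \<open>The affine points of a non-vertical line have distinct abscissas, so in lexicographic
  order \<open>lt x\<close> of them precede \<open>Aff x y\<close> and \<open>gt x\<close> follow,
  whatever the slope. The point at infinity adds one to either side. On the vertical line the
  ordinates decide instead, and \<open>Vert\<close> has key 0.\<close>

lemma mids_Aff:
  "mids (Aff x y) = (\<Sum>m\<in>UNIV. (lt x + of_bool (key (Slope m) < key (Aff x y)))
        * (gt x + of_bool (key (Aff x y) < key (Slope m))))
     + (lt y + of_bool (0 < key (Aff x y))) * (gt y + of_bool (key (Aff x y) < 0))"
proof -
  have "{x'. x' \<noteq> x \<and> k x' < k x} = {x'. k x' < k x}" "{x'. x' \<noteq> x \<and> k x < k x'} = {x'. k x < k x'}" for x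
    by auto
  moreover have "{x'. x' \<noteq> x \<and> (k x' < k x \<or> x' = x \<and> P x')} = {x'. k x' < k x}"
    "{x'. x' \<noteq> x \<and> (k x < k x' \<or> x = x' \<and> P x')} = {x'. k x < k x'}" for x P
    by auto
  ultimately show ?thesis
    by (simp add: mids_eq before_def after_def card_dir_class key_Aff_less_iff lt_def gt_def)
qed

lemma mids_Slope:
  "mids (Slope m) = (\<Sum>b\<in>UNIV. card {x. key (Aff x (m * x + b)) < key (Slope m)}
        * card {x. key (Slope m) < key (Aff x (m * x + b))})
     + (lt m + of_bool (0 < key (Slope m))) * (gt m + of_bool (key (Slope m) < 0))"
proof -
  have "{m'. m' \<noteq> m \<and> k m' < k m} = {m'. k m' < k m}" "{m'. m' \<noteq> m \<and> k m < k m'} = {m'. k m < k m'}"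
    by auto
  then show ?thesis
    by (simp add: mids_eq before_def after_def card_dir_class key_Slope_less_iff lt_def gt_def)
qed

lemma less_key_Slope: "key (Aff x y) < key (Slope m) \<longleftrightarrow> 0 < k m \<or> k m = 0 \<and> key (Aff x y) < 0"
  using key_Slope_less_Aff[of m x y] key_Slope_neq_Aff[of m x y] key_Aff_neq[of x y] by linarith

text \<open>Each of the \<open>q + 1\<close> lines through \<open>Aff x x\<close> or \<open>Slope x\<close> is split by this point as evenly as
  possible.\<close>

lemma mids_centre:
  assumes "k x = 0"
  shows "mids (Slope x) = mids (Aff x x)"
proof -
  define h where "h = lt x"
  have gt: "gt x = h" using lt_cj[of x] by (simp add: cj_fixed[OF assms] h_def)
  have key: "key (Aff x x) = -1" "key (Slope x) = 1"
    using assms by (simp_all add: key.simps lx_def sl_def)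
  have "mids (Aff x x) = (\<Sum>m\<in>(UNIV :: 'a set). h * (h + 1)) + h * (h + 1)"
  proof -
    have "(h + of_bool (key (Slope m) < key (Aff x x))) * (h + of_bool (key (Aff x x) < key (Slope m)))
        = h * (h + 1)" for m
      using key_Slope_neq_Aff[of m x x] by (cases "key (Slope m)" "key (Aff x x)" rule: linorder_cases) auto
    then show ?thesis unfolding mids_Aff by (simp add: gt h_def[symmetric] key)
  qed
  moreover have "mids (Slope x) = (\<Sum>b\<in>(UNIV :: 'a set). h * (h + 1)) + h * (h + 1)"
  proof -
    have "card {z. key (Aff z (x * z + b)) < 1} * card {z. 1 < key (Aff z (x * z + b))} = h * (h + 1)" for b
    proof -
      have pos: "1 < key (Aff z y) \<longleftrightarrow> 0 < k z \<or> k z = 0 \<and> 0 < k y" for z y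
        using key_Aff_pos_iff[of z y] key_Aff_neq[of z y] by linarith
      have neg: "key (Aff z y) < 1 \<longleftrightarrow> k z < 0 \<or> k z = 0 \<and> k y \<le> 0" for z y
        using key_Aff_pos_iff[of z y] key_Aff_neq[of z y] by linarith
      have zero: "k z = 0 \<longleftrightarrow> z = x" for z
        using k_eq_iff[of z x] assms by simp
      have lt: "card {z. k z < 0} = h" and gt': "card {z. 0 < k z} = h"
        using gt by (simp_all add: h_def lt_def gt_def assms)
      show ?thesis
      \<comment> \<open>The point of this line with abscissa \<open>x\<close> is the only one whose
        side depends on \<open>b\<close>. If its ordinate has \<open>k\<close>-value 0, it is the
        affine centre, whose key -1 puts it before \<open>Slope x\<close>.\<close>
      proof (cases "0 < k (x * x + b)")
        case True
        then have "{z. key (Aff z (x * z + b)) < 1} = {z. k z < 0}"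
          "{z. 1 < key (Aff z (x * z + b))} = insert x {z. 0 < k z}"
          using assms by (auto simp: pos neg zero)
        then show ?thesis using assms lt gt' by simp
      next
        case False
        then have "{z. key (Aff z (x * z + b)) < 1} = insert x {z. k z < 0}"
          "{z. 1 < key (Aff z (x * z + b))} = {z. 0 < k z}"
          using assms by (auto simp: pos neg zero)
        then show ?thesis using assms lt gt' by simp
      qed
    qed
    then show ?thesis unfolding mids_Slope by (simp add: gt h_def[symmetric] key)
  qed
  ultimately show ?thesis by simp
qed

text \<open>Reversal exchanges \<open>lt\<close> and \<open>gt\<close> and permutes the slopes by
  \<open>cj\<close>, which only swaps the factors in \<open>mids_Aff\<close>. A noncentral direction
  has all affine points on one side, so only the line at infinity contributes. The two central
  points besides \<open>Vert\<close> are compared in \<open>mids_centre\<close>.\<close>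

lemma mids_star: "mids (star p) = mids p"
proof (cases p)
  case (Aff x y)
  show ?thesis
  proof (cases "lx x y = 0")
    case True
    then have "k x = 0" "y = x" using k_eq_iff[of y x] by (auto simp: lx_zero_iff)
    then show ?thesis using True Aff mids_centre by simp
  next
    case False
    let ?p = "Aff x y" and ?p' = "Aff (cj x) (cj y)"
    have key: "key ?p' = - key ?p"
      using key_star[of ?p] False by simp
    \<comment> \<open>A central slope keeps its key 1 under \<open>cj\<close> instead of changing
      sign. This does no harm, since the key of a noncentral affine point is even and
      nonzero.\<close>
    have s: "key (Slope (cj m)) < - key ?p \<longleftrightarrow> key ?p < key (Slope m)"
      "- key ?p < key (Slope (cj m)) \<longleftrightarrow> key (Slope m) < key ?p" for m
      using key_Slope_less_Aff[of "cj m" "cj x" "cj y"] less_key_Slope[of "cj x" "cj y" "cj m"]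
        key_Slope_less_Aff[of m x y] less_key_Slope[of x y m] by (auto simp: key)
    have "mids ?p' = (\<Sum>m\<in>UNIV. (gt x + of_bool (key (Slope m) < - key ?p))
        * (lt x + of_bool (- key ?p < key (Slope m)))) + (gt y + of_bool (key ?p < 0)) * (lt y + of_bool (0 < key ?p))"
      unfolding mids_Aff lt_cj gt_cj key by simp
    also have "(\<Sum>m\<in>UNIV. (gt x + of_bool (key (Slope m) < - key ?p)) * (lt x + of_bool (- key ?p < key (Slope m))))
        = (\<Sum>m\<in>UNIV. (gt x + of_bool (key ?p < key (Slope m))) * (lt x + of_bool (key (Slope m) < key ?p)))"
      by (subst sum.reindex_bij_betw[OF bij_cj, symmetric]) (simp only: s)
    also have "\<dots> + (gt y + of_bool (key ?p < 0)) * (lt y + of_bool (0 < key ?p)) = mids ?p"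
      unfolding mids_Aff by (simp add: mult.commute)
    finally show ?thesis using False Aff by simp
  qed
next
  case (Slope m)
  show ?thesis
  proof (cases "k m = 0")
    case True
    then show ?thesis using Slope mids_centre by (simp add: sl_simps)
  next
    case False
    have *: "mids (Slope m) = (lt m + of_bool (0 < k m)) * (gt m + of_bool (k m < 0))" if "k m \<noteq> 0" for m
    proof -
      have "card {x. key (Aff x (m * x + b)) < key (Slope m)} * card {x. key (Slope m) < key (Aff x (m * x + b))} = 0" for b
        using that by (cases "k m" "0 :: int" rule: linorder_cases) (auto simp: key_Slope_less_Aff less_key_Slope)
      moreover have "0 < key (Slope m) \<longleftrightarrow> 0 < k m" "key (Slope m) < 0 \<longleftrightarrow> k m < 0"
        using key_Slope_pos_iff[of m] key_Slope_neq[of m] that by linarith+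
      ultimately show ?thesis unfolding mids_Slope by simp
    qed
    show ?thesis
      using *[OF False] *[of "cj m"] False Slope by (simp add: sl_simps lt_cj gt_cj mult.commute)
  qed
qed simp

section \<open>Positions of the points and the balance of medians\<close>

definition pos :: "'a pt \<Rightarrow> nat" where "pos p = card {s. key s < key p}"

lemma pos_less_iff: "pos p < pos s \<longleftrightarrow> key p < key s"
proof -
  have *: "pos p < pos s" if "key p < key s" for p s
    unfolding pos_def using that by (intro psubset_card_mono) auto
  show ?thesis
    using *[of p s] *[of s p] by (cases "key p" "key s" rule: linorder_cases) auto
qed

lemma inj_pos: "inj pos"
proof (rule injI)
  fix p s assume "pos p = pos s"
  then show "p = s"
    using pos_less_iff[of p s] pos_less_iff[of s p]
    by (cases "key p" "key s" rule: linorder_cases) auto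
qed

lemma pos_bij: "bij_betw pos UNIV {..<CARD('a pt)}"
proof -
  have "pos p < CARD('a pt)" for p
    unfolding pos_def by (rule psubset_card_mono) auto
  then have "range pos \<subseteq> {..<CARD('a pt)}" by auto
  moreover have "card (range pos) = card {..<CARD('a pt)}"
    using card_image[OF inj_pos] by simp
  ultimately have "range pos = {..<CARD('a pt)}"
    by (intro card_subset_eq) auto
  then show ?thesis using inj_pos by (simp add: bij_betw_def)
qed

text \<open>As \<open>star\<close> reverses the ordering, the points before \<open>star p\<close>
  correspond to those after \<open>p\<close>.\<close>

lemma pos_star: "pos p + pos (star p) + 1 = CARD('a pt)"
proof -
  have img: "{s. key s < key (star p)} = star ` {s. key p < key s}"
  proof (intro equalityI subsetI)
    fix s assume "s \<in> {s. key s < key (star p)}"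
    then have "star s \<in> {s. key p < key s}" by (simp add: key_star)
    then show "s \<in> star ` {s. key p < key s}" by (metis star_star image_eqI)
  qed (auto simp: key_star)
  have "inj star" by (metis star_star injI)
  then have "pos (star p) = card {s. key p < key s}"
    unfolding pos_def img by (metis card_image inj_on_subset subset_UNIV)
  moreover have "card (({s. key s < key p} \<union> {p}) \<union> {s. key p < key s})
      = card {s. key s < key p} + 1 + card {s. key p < key s}"
  proof -
    have "({s. key s < key p} \<union> {p}) \<inter> {s. key p < key s} = {}" "{s. key s < key p} \<inter> {p} = {}"
      by auto
    then show ?thesis by (simp only: card_Un_disjoint finite_code) simp
  qed
  moreover have "s \<in> ({s. key s < key p} \<union> {p}) \<union> {s. key p < key s}" for s
    by (cases "key s" "key p" rule: linorder_cases) auto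
  then have "({s. key s < key p} \<union> {p}) \<union> {s. key p < key s} = UNIV"
    by blast
  ultimately show ?thesis by (simp only: pos_def)
qed

text \<open>Replacing \<open>p\<close> by \<open>star p\<close> negates the first factor by
  \<open>pos_star\<close> and keeps the second by \<open>mids_star\<close>.\<close>

lemma sum_mids_balanced: "(\<Sum>p\<in>UNIV. (2 * int (pos p) - (int CARD('a pt) - 1)) * int (mids p)) = 0"
proof -
  let ?f = "\<lambda>p. (2 * int (pos p) - (int CARD('a pt) - 1)) * int (mids p)"
  have "bij star" by (rule o_bij[of star star]) auto
  then have "sum ?f UNIV = (\<Sum>p\<in>UNIV. ?f (star p))"
    by (rule sum.reindex_bij_betw[symmetric])
  also have "\<dots> = (\<Sum>p\<in>UNIV. - ?f p)"
  proof (rule sum.cong)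
    fix p
    have "2 * int (pos (star p)) - (int CARD('a pt) - 1) = - (2 * int (pos p) - (int CARD('a pt) - 1))"
      using pos_star[of p] by linarith
    then show "?f (star p) = - ?f p" unfolding mids_star by (simp only: mult_minus_left)
  qed simp
  finally show ?thesis by (simp add: sum_negf)
qed

end

section \<open>Transitivity of the projective group\<close>

lemma det3_matrix: "det3 (A *v u) (A *v v) (A *v w) = det A * det3 u v w"
proof -
  have "(vector [A *v u, A *v v, A *v w] :: 'a ^ 3 ^ 3) = vector [u, v, w] ** transpose A"
    by (simp add: vec_eq_iff forall_3 vector_3 matrix_matrix_mult_def matrix_vector_mult_def transpose_def
        sum_3 mult.commute)
  then show ?thesis
    by (simp add: det3_def det_mul det_transpose)
qed

lemma det3_scale: "det3 (a *s u) (b *s v) (c *s w) = a * b * c * det3 u v w"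
  by (simp add: det3_expand algebra_simps)

lemma det3_cramer:
  fixes a b c d :: "'a::field ^ 3"
  shows "det3 a b c *s d = det3 d b c *s a + det3 a d c *s b + det3 a b d *s c"
  by (simp add: vec_eq_iff forall_3 det3_expand algebra_simps)

definition cols :: "'a::comm_ring_1 ^ 3 \<Rightarrow> 'a ^ 3 \<Rightarrow> 'a ^ 3 \<Rightarrow> 'a ^ 3 ^ 3" where
  "cols u v w = transpose (vector [u, v, w])"

lemma cols_mult: "cols u v w *v vector [x, y, z] = x *s u + y *s v + z *s w"
  by (simp add: cols_def vec_eq_iff forall_3 vector_3 matrix_vector_mult_def transpose_def sum_3 mult.commute)

lemma invertible_cols: "invertible (cols u v w) \<longleftrightarrow> det3 u v w \<noteq> (0 :: 'a::field)"
  by (simp add: invertible_det_nz cols_def det_transpose det3_def)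

section \<open>Projective points as spans of normalised vectors\<close>

lemma span_scale:
  fixes v :: "'a::field ^ 'n"
  assumes "c \<noteq> 0"
  shows "vec.span {c *s v} = vec.span {v}"
proof -
  have "range (\<lambda>k. k *s (c *s v)) = range (\<lambda>k. k *s v)"
  proof (intro equalityI subsetI)
    fix u assume "u \<in> range (\<lambda>k. k *s v)"
    then obtain k where "u = k *s v" by blast
    then have "u = (k / c) *s (c *s v)" using assms by (simp add: vector_smult_assoc)
    then show "u \<in> range (\<lambda>k. k *s (c *s v))" by blast
  qed (auto simp: vector_smult_assoc)
  then show ?thesis by (simp add: vec.span_singleton)
qed

lemma image_span:
  fixes A :: "'a::field ^ 'n ^ 'm"
  shows "(\<lambda>u. A *v u) ` vec.span {v} = vec.span {A *v v}"
  by (simp add: vec.span_singleton image_image vector_scalar_commute)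

definition pnt :: "'a::{field,finite} pt \<Rightarrow> ('a ^ 3) set" where
  "pnt p = vec.span {hom p}"

lemma hom_nonzero: "hom p \<noteq> (0 :: 'a::comm_ring_1 ^ 3)"
  by (cases p) (auto simp: vec_eq_iff forall_3 vector_3)

lemma nonzero_eq_scaled_hom:
  fixes v :: "'a::field ^ 3"
  assumes "v \<noteq> 0"
  obtains p c where "c \<noteq> 0" "v = c *s hom p"
proof -
  have "\<exists>p c. c \<noteq> 0 \<and> v = c *s hom p"
  proof (cases "v $ 1 = 0")
    case False
    then have "v = v $ 1 *s hom (Aff (v $ 2 / v $ 1) (v $ 3 / v $ 1))"
      by (simp add: vec_eq_iff forall_3)
    with False show ?thesis by blast
  next
    case v1: True
    show ?thesis
    proof (cases "v $ 2 = 0")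
      case False
      then have "v = v $ 2 *s hom (Slope (v $ 3 / v $ 2))"
        using v1 by (simp add: vec_eq_iff forall_3)
      with False show ?thesis by blast
    next
      case True
      then have "v = v $ 3 *s hom Vert" "v $ 3 \<noteq> 0"
        using v1 assms by (simp_all add: vec_eq_iff forall_3)
      then show ?thesis by blast
    qed
  qed
  then show ?thesis using that by blast
qed

lemma span_in_pg_points:
  fixes v :: "'a::{field,finite} ^ 3"
  assumes "v \<noteq> 0"
  shows "vec.span {v} \<in> pg_points"
  using assms by (simp add: pg_points_def vec.subspace_span)

lemma pg_points_eq_span:
  assumes "L \<in> (pg_points :: ('a::{field,finite} ^ 3) set set)"
  obtains v where "v \<noteq> 0" "L = vec.span {v}"
proof -
  have L: "vec.subspace L" "vec.dim L = 1" using assms by (auto simp: pg_points_def)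
  then obtain v where v: "v \<in> L" "v \<noteq> 0"
    by (metis One_nat_def insertI1 subsetI vec.dim_eq_0 zero_neq_one)
  have "vec.span {v} = L"
    using v L by (intro vec.subspace_dim_equal) (auto simp: vec.subspace_span vec.span_minimal)
  with v that show ?thesis by blast
qed

lemma bij_pnt: "bij_betw pnt UNIV (pg_points :: ('a::{field,finite} ^ 3) set set)"
  unfolding bij_betw_def
proof
  show "inj (pnt :: 'a pt \<Rightarrow> _)"
  proof (rule injI)
    fix p s :: "'a pt" assume "pnt p = pnt s"
    then have "hom p \<in> vec.span {hom s}"
      unfolding pnt_def by (metis insertI1 vec.span_base)
    then obtain c where "hom p = c *s hom s"
      by (auto simp: vec.span_singleton)
    then show "p = s"
      by (cases p; cases s) (auto simp: vec_eq_iff forall_3)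
  qed
  show "range pnt = (pg_points :: ('a ^ 3) set set)"
  proof (intro equalityI subsetI)
    fix L :: "('a ^ 3) set" assume "L \<in> pg_points"
    then obtain v where v: "v \<noteq> 0" "L = vec.span {v}" by (rule pg_points_eq_span)
    obtain p c where "c \<noteq> 0" "v = c *s hom p" by (rule nonzero_eq_scaled_hom[OF v(1)])
    with v(2) show "L \<in> range pnt" by (auto simp: pnt_def span_scale)
  qed (auto simp: pnt_def span_in_pg_points hom_nonzero)
qed

lemma pnt_in_pg_points [simp]: "pnt p \<in> pg_points"
  by (simp add: pnt_def span_in_pg_points hom_nonzero)

lemma inj_pnt: "inj pnt"
  by (rule bij_betw_imp_inj_on[OF bij_pnt])

lemma pgl_of_matrix:
  fixes A :: "'a::{field,finite} ^ 3 ^ 3"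
  assumes "invertible A"
  obtains f where "f \<in> pgl" "\<And>v. v \<noteq> 0 \<Longrightarrow> f (vec.span {v}) = vec.span {A *v v}"
proof -
  \<comment> \<open>The map is the identity off the points because \<open>permutes\<close> asks for
    it.\<close>
  define f where "f L = (if L \<in> pg_points then (\<lambda>v. A *v v) ` L else L)" for L
  from assms obtain B where B: "A ** B = mat 1" "B ** A = mat 1"
    unfolding invertible_def by blast
  have AB: "A *v (B *v v) = v" "B *v (A *v v) = v" for v
    by (simp_all add: matrix_vector_mul_assoc B)
  have img: "(\<lambda>v. M *v v) ` L \<in> pg_points" if M: "M \<in> {A, B}" and L: "L \<in> pg_points" for M L
  proof -
    obtain v where v: "v \<noteq> 0" "L = vec.span {v}" using pg_points_eq_span[OF L] .
    have "M *v v \<noteq> 0" using M v(1) AB[of v] by auto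
    then show ?thesis unfolding v(2) image_span by (rule span_in_pg_points)
  qed
  have "bij_betw f pg_points pg_points"
    by (rule bij_betw_byWitness[where f' = "\<lambda>L. (\<lambda>v. B *v v) ` L"])
      (auto simp: f_def image_image AB img)
  then have "f permutes pg_points"
    by (rule bij_imp_permutes) (simp add: f_def)
  moreover have "f L = (\<lambda>v. A *v v) ` L" if "L \<in> pg_points" for L
    using that by (simp add: f_def)
  ultimately have "f \<in> pgl" using assms by (auto simp: pgl_def)
  then show ?thesis
    using that by (simp add: f_def span_in_pg_points image_span)
qed

text \<open>A matrix inducing \<open>f\<close> sends normalised representatives to nonzero multiples
  of normalised representatives, so the determinant testing collinearity changes by a nonzero
  factor.\<close>

lemma pgl_col_iff:
  assumes "f \<in> pgl" "f (pnt p) = pnt p'" "f (pnt s) = pnt s'" "f (pnt t) = pnt t'"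
  shows "col p' s' t' \<longleftrightarrow> col p s t"
proof -
  from assms(1) obtain A where A: "invertible A" "\<And>L. L \<in> pg_points \<Longrightarrow> f L = (\<lambda>v. A *v v) ` L"
    unfolding pgl_def by blast
  have scaled: "\<exists>c. c \<noteq> 0 \<and> A *v hom p = c *s hom p'" if "f (pnt p) = pnt p'" for p p'
  proof -
    have "vec.span {A *v hom p} = vec.span {hom p'}"
      using that A(2)[of "pnt p"] pnt_in_pg_points[of p] by (simp add: pnt_def image_span)
    then have "A *v hom p \<in> vec.span {hom p'}" "hom p' \<in> vec.span {A *v hom p}"
      using vec.span_base[of "A *v hom p" "{A *v hom p}"] vec.span_base[of "hom p'" "{hom p'}"] by simp_all
    then obtain c d where "A *v hom p = c *s hom p'" "hom p' = d *s (A *v hom p)"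
      unfolding vec.span_singleton by blast
    moreover have "c \<noteq> 0" using calculation hom_nonzero[of p'] by (metis vector_smult_lzero vector_smult_rzero)
    ultimately show ?thesis by blast
  qed
  obtain a where a: "a \<noteq> 0" "A *v hom p = a *s hom p'" using scaled[OF assms(2)] by blast
  obtain b where b: "b \<noteq> 0" "A *v hom s = b *s hom s'" using scaled[OF assms(3)] by blast
  obtain c where c: "c \<noteq> 0" "A *v hom t = c *s hom t'" using scaled[OF assms(4)] by blast
  have "det A * det3 (hom p) (hom s) (hom t) = a * b * c * det3 (hom p') (hom s') (hom t')"
    using det3_matrix[of A "hom p" "hom s" "hom t"] by (simp add: a b c det3_scale)
  moreover have "det A \<noteq> 0" using A(1) by (simp add: invertible_det_nz)
  ultimately show ?thesis
    using a b c by (auto simp: col_def)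
qed

text \<open>A common form of the two kinds of orbits: quadrangles for \<open>e = False\<close>, and
  for \<open>e = True\<close> three collinear points \<open>p1\<close>, \<open>p2\<close>,
  \<open>p4\<close> with \<open>p3\<close> off their line. Distinctness is implied, because
  determinants with a repeated point vanish.\<close>

definition generic4 :: "bool \<Rightarrow> 'a::comm_ring_1 pt \<Rightarrow> 'a pt \<Rightarrow> 'a pt \<Rightarrow> 'a pt \<Rightarrow> bool" where
  "generic4 e p1 p2 p3 p4 \<longleftrightarrow> \<not> col p1 p2 p3 \<and> \<not> col p4 p2 p3 \<and> \<not> col p1 p4 p3 \<and> (col p1 p2 p4 \<longleftrightarrow> e)"

text \<open>By \<open>det3_cramer\<close>, \<open>p4\<close> is a combination of the basis
  \<open>p1\<close>, \<open>p2\<close>, \<open>p3\<close> in which the coefficient of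
  \<open>p3\<close> vanishes iff \<open>e\<close>. Absorbing the nonzero coefficients into the basis
  vectors turns \<open>p4\<close> into (1, 1, 1) or (1, 1, 0).\<close>

lemma generic4_standard:
  assumes "generic4 e p1 p2 p3 (p4 :: 'a::{field,finite} pt)"
  obtains f where "f \<in> pgl"
    "f (vec.span {vector [1, 0, 0]}) = pnt p1" "f (vec.span {vector [0, 1, 0]}) = pnt p2"
    "f (vec.span {vector [0, 0, 1]}) = pnt p3"
    "f (vec.span {vector [1, 1, of_bool (\<not> e)]}) = pnt p4"
proof -
  define D where "D = det3 (hom p1) (hom p2) (hom p3)"
  define \<alpha> where "\<alpha> = det3 (hom p4) (hom p2) (hom p3)"
  define \<beta> where "\<beta> = det3 (hom p1) (hom p4) (hom p3)"
  \<comment> \<open>If \<open>e\<close> holds, the true coefficient is 0, and 1 is put in its place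
    to keep the matrix invertible.\<close>
  define \<gamma> where "\<gamma> = (if e then 1 else det3 (hom p1) (hom p2) (hom p4))"
  have nz: "D \<noteq> 0" "\<alpha> \<noteq> 0" "\<beta> \<noteq> 0" "\<gamma> \<noteq> 0" "e \<longleftrightarrow> det3 (hom p1) (hom p2) (hom p4) = 0"
    using assms by (auto simp: generic4_def col_def D_def \<alpha>_def \<beta>_def \<gamma>_def)
  let ?A = "cols (\<alpha> *s hom p1) (\<beta> *s hom p2) (\<gamma> *s hom p3)"
  have "invertible ?A"
    using nz by (simp add: invertible_cols det3_scale D_def[symmetric])
  then obtain f where f: "f \<in> pgl" "\<And>v. v \<noteq> 0 \<Longrightarrow> f (vec.span {v}) = vec.span {?A *v v}"
    by (rule pgl_of_matrix) blast
  have D: "?A *v vector [1, 1, of_bool (\<not> e)] = D *s hom p4"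
    using det3_cramer[of "hom p1" "hom p2" "hom p3" "hom p4"] nz(5)
    by (simp add: cols_mult D_def \<alpha>_def \<beta>_def \<gamma>_def)
  have vnz: "vector [1, 0, 0] \<noteq> (0 :: 'a ^ 3)" "vector [0, 1, 0] \<noteq> (0 :: 'a ^ 3)"
    "vector [0, 0, 1] \<noteq> (0 :: 'a ^ 3)" "vector [1, 1, of_bool (\<not> e)] \<noteq> (0 :: 'a ^ 3)"
    by (auto simp: vec_eq_iff forall_3)
  show ?thesis
  proof (rule that[OF f(1)])
    show "f (vec.span {vector [1, 1, of_bool (\<not> e)]}) = pnt p4"
      unfolding f(2)[OF vnz(4)] D using nz by (simp add: span_scale pnt_def)
  qed (use nz in \<open>simp_all add: f(2)[OF vnz(1)] f(2)[OF vnz(2)] f(2)[OF vnz(3)] cols_mult span_scale pnt_def\<close>)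
qed

lemma pgl_transitive:
  assumes "generic4 e p1 p2 p3 p4" "generic4 e s1 s2 s3 (s4 :: 'a::{field,finite} pt)"
  obtains f where "f \<in> pgl" "f (pnt p1) = pnt s1" "f (pnt p2) = pnt s2"
    "f (pnt p3) = pnt s3" "f (pnt p4) = pnt s4"
proof -
  obtain f where f: "f \<in> pgl"
    "f (vec.span {vector [1, 0, 0]}) = pnt p1" "f (vec.span {vector [0, 1, 0]}) = pnt p2"
    "f (vec.span {vector [0, 0, 1]}) = pnt p3" "f (vec.span {vector [1, 1, of_bool (\<not> e)]}) = pnt p4"
    using generic4_standard[OF assms(1)] by metis
  obtain g where g: "g \<in> pgl"
    "g (vec.span {vector [1, 0, 0]}) = pnt s1" "g (vec.span {vector [0, 1, 0]}) = pnt s2"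
    "g (vec.span {vector [0, 0, 1]}) = pnt s3" "g (vec.span {vector [1, 1, of_bool (\<not> e)]}) = pnt s4"
    using generic4_standard[OF assms(2)] by metis
  have "f permutes pg_points" using f(1) by (simp add: pgl_def)
  then have inv: "inv f (f L) = L" for L by (simp add: permutes_inverses)
  show ?thesis
  proof (rule that)
    show "g \<circ> inv f \<in> pgl" by (intro pgl_comp pgl_inv f(1) g(1))
  qed (simp_all add: f(2-5)[symmetric] g(2-5)[symmetric] inv)
qed

text \<open>The elements taking \<open>s\<close> to a given \<open>t\<close> form a coset of the
  stabiliser of \<open>s\<close>, so each \<open>t\<close> in the orbit is reached equally
  often.\<close>

lemma orbit_count:
  fixes \<Psi> :: "('b \<Rightarrow> 'b) set"
  assumes fin: "finite \<Psi>" "finite \<Omega>"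
    and bij: "\<And>\<sigma>. \<sigma> \<in> \<Psi> \<Longrightarrow> bij \<sigma>"
    and comp: "\<And>\<sigma> \<tau>. \<lbrakk>\<sigma> \<in> \<Psi>; \<tau> \<in> \<Psi>\<rbrakk> \<Longrightarrow> \<sigma> \<circ> \<tau> \<in> \<Psi>"
    and inv: "\<And>\<sigma>. \<sigma> \<in> \<Psi> \<Longrightarrow> inv \<sigma> \<in> \<Psi>"
    and stable: "\<And>\<sigma> t. \<lbrakk>\<sigma> \<in> \<Psi>; t \<in> \<Omega>\<rbrakk> \<Longrightarrow> map \<sigma> t \<in> \<Omega>"
    and trans: "\<And>t. t \<in> \<Omega> \<Longrightarrow> \<exists>\<sigma>\<in>\<Psi>. map \<sigma> s = t"
    and s: "s \<in> \<Omega>"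
  shows "card {\<sigma> \<in> \<Psi>. P (map \<sigma> s)} * card \<Omega> = card \<Psi> * card {t \<in> \<Omega>. P t}"
proof -
  let ?F = "\<lambda>t. {\<sigma> \<in> \<Psi>. map \<sigma> s = t}"
  have fiber: "card (?F t) = card (?F s)" if t: "t \<in> \<Omega>" for t
  proof -
    obtain \<tau> where \<tau>: "\<tau> \<in> \<Psi>" "map \<tau> s = t" using trans[OF t] by blast
    have b: "inv \<tau> \<circ> \<tau> = id" "\<tau> \<circ> inv \<tau> = id"
      using bij[OF \<tau>(1)] by (simp_all add: bij_is_inj bij_is_surj inv_o_cancel surj_iff[symmetric])
    have inv_t: "map (inv \<tau>) t = s"
      unfolding \<tau>(2)[symmetric] by (simp add: b(1))
    have "bij_betw (\<lambda>\<sigma>. \<tau> \<circ> \<sigma>) (?F s) (?F t)"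
    proof (rule bij_betw_byWitness[where f' = "\<lambda>\<sigma>. inv \<tau> \<circ> \<sigma>"])
      show "(\<circ>) \<tau> ` ?F s \<subseteq> ?F t"
        using \<tau> comp by (auto simp flip: map_map)
      show "(\<circ>) (inv \<tau>) ` ?F t \<subseteq> ?F s"
        using \<tau>(1) inv comp inv_t by (auto simp flip: map_map)
    qed (auto simp: b comp_assoc[symmetric])
    then show ?thesis by (rule bij_betw_same_card[symmetric])
  qed
  have count: "card {\<sigma> \<in> \<Psi>. Q (map \<sigma> s)} = card {t \<in> \<Omega>. Q t} * card (?F s)" for Q
  proof -
    have "{\<sigma> \<in> \<Psi>. Q (map \<sigma> s)} = (\<Union>t \<in> {t \<in> \<Omega>. Q t}. ?F t)"
      using stable s by auto
    also have "card \<dots> = (\<Sum>t \<in> {t \<in> \<Omega>. Q t}. card (?F t))"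
      by (rule card_UN_disjoint) (auto simp: fin)
    also have "\<dots> = card {t \<in> \<Omega>. Q t} * card (?F s)"
      by (simp add: fiber)
    finally show ?thesis .
  qed
  show ?thesis
    using count[of P] count[of "\<lambda>_. True"] by simp
qed

lemma covers_iff_sorted: "covers \<pi> s \<longleftrightarrow> sorted_wrt (<) (map (inv \<pi>) s)"
  by (auto simp: covers_def sorted_wrt_iff_nth_Suc_transp)

section \<open>Coverage of sequences\<close>

context centered_order
begin

definition at_pos :: "nat \<Rightarrow> 'a pt" where "at_pos = inv_into UNIV pos"

lemma at_pos_pos [simp]: "at_pos (pos p) = p"
  unfolding at_pos_def by (simp add: inj_pos)

lemma pos_at_pos [simp]: "i < CARD('a pt) \<Longrightarrow> pos (at_pos i) = i"
  unfolding at_pos_def using bij_betw_inv_into_right[OF pos_bij] by simp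

lemma pos_bound [simp]: "pos p < CARD('a pt)"
  using bij_betwE[OF pos_bij] by auto

lemma at_pos_inj: "\<lbrakk>i < CARD('a pt); j < CARD('a pt); at_pos i = at_pos j\<rbrakk> \<Longrightarrow> i = j"
  by (metis pos_at_pos)

definition coln :: "nat \<Rightarrow> nat \<Rightarrow> nat \<Rightarrow> bool" where
  "coln i j l \<longleftrightarrow> col (at_pos i) (at_pos j) (at_pos l)"

sublocale pg: ordered_linear_space "CARD('a pt)" "CARD('a) - 1" coln
proof
  show "coln a b c \<Longrightarrow> coln b a c" "coln a b c \<Longrightarrow> coln a c b" for a b c
    unfolding coln_def by (fact col_swap12 col_swap23)+
  show "coln a c d"
    if "a < CARD('a pt)" "b < CARD('a pt)" "c < CARD('a pt)" "d < CARD('a pt)" "a \<noteq> b" "coln a b c" "coln a b d"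
    for a b c d
    using that at_pos_inj[of a b] col_line[of "at_pos a" "at_pos b"] unfolding coln_def by auto
  show "card {c. c < CARD('a pt) \<and> c \<noteq> a \<and> c \<noteq> b \<and> coln a b c} = CARD('a) - 1"
    if "a < CARD('a pt)" "b < CARD('a pt)" "a \<noteq> b" for a b
  proof -
    have "{c. c < CARD('a pt) \<and> c \<noteq> a \<and> c \<noteq> b \<and> coln a b c}
        = pos ` {t. t \<noteq> at_pos a \<and> t \<noteq> at_pos b \<and> col (at_pos a) (at_pos b) t}" (is "?L = pos ` ?R")
    proof (intro equalityI subsetI)
      fix c assume "c \<in> ?L"
      then have "at_pos c \<in> ?R" "pos (at_pos c) = c"
        using that at_pos_inj[of c a] at_pos_inj[of c b] by (auto simp: coln_def)
      then show "c \<in> pos ` ?R" by (intro image_eqI[of c pos "at_pos c"]) simp_all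
    qed (use that in \<open>auto simp: coln_def\<close>)
    then have "card ?L = card ?R"
      using card_image[OF inj_on_subset[OF inj_pos subset_UNIV]] by simp
    also have "\<dots> = CARD('a) - 1"
      using that at_pos_inj[of a b] by (intro card_line_pt) auto
    finally show ?thesis .
  qed
qed

text \<open>Grouping the collinear triples by their median \<open>p\<close> gives each position the
  weight \<open>mids p\<close>, and the sum becomes that of
  \<open>sum_mids_balanced\<close>.\<close>

lemma balanced: "pg.med_balanced"
proof -
  let ?S = "\<lambda>p. {(s, t). key s < key p \<and> key p < key t \<and> col s p t}"
  let ?g = "\<lambda>x. 2 * int x - (int CARD('a pt) - 1)"
  have "(\<Sum>(a, b, c) \<in> pg.triples. ?g b) = (\<Sum>(p, s, t) \<in> Sigma UNIV ?S. ?g (pos p))"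
    by (rule sum.reindex_bij_witness[where i = "\<lambda>(p, s, t). (pos s, pos p, pos t)"
          and j = "\<lambda>(a, b, c). (at_pos b, at_pos a, at_pos c)"])
      (auto simp: pg.triples_def coln_def pos_less_iff[symmetric])
  also have "\<dots> = (\<Sum>p\<in>UNIV. \<Sum>st\<in>?S p. ?g (pos p))"
    by (subst sum.Sigma) (auto simp: case_prod_unfold)
  also have "\<dots> = (\<Sum>p\<in>UNIV. ?g (pos p) * int (mids p))"
    by (simp add: mids_def mult.commute)
  also have "\<dots> = 0" by (rule sum_mids_balanced)
  finally show ?thesis unfolding pg.med_balanced_def .
qed

definition psi :: "('a ^ 3) set \<Rightarrow> nat" where "psi L = pos (inv_into UNIV pnt L)"

lemma psi_pnt [simp]: "psi (pnt p) = pos p"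
  by (simp add: psi_def inj_pnt)

lemma bij_psi: "bij_betw psi pg_points {..<CARD('a pt)}"
  unfolding psi_def using bij_betw_trans[OF bij_betw_inv_into[OF bij_pnt] pos_bij] by (simp add: comp_def)

lemma inv_psi: "i < CARD('a pt) \<Longrightarrow> inv_into pg_points psi i = pnt (at_pos i)"
  using bij_betw_inv_into_left[OF bij_psi, of "pnt (at_pos i)"] by simp

abbreviation rep :: "(nat \<Rightarrow> nat) set" where "rep \<equiv> pgl_rep CARD('a pt) psi"

lemma rep_permutes: "\<sigma> \<in> rep \<Longrightarrow> \<sigma> permutes {..<CARD('a pt)}"
  using pgl_rep_group(1)[OF bij_psi] by blast

lemma transport_pnt:
  assumes "f \<in> pgl" "i < CARD('a pt)" "f (pnt (at_pos i)) = pnt p"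
  shows "transport_perm CARD('a pt) psi f i = pos p"
  using assms by (simp add: transport_perm_def inv_psi)

lemma rep_coln:
  assumes "\<sigma> \<in> rep" "i < CARD('a pt)" "j < CARD('a pt)" "l < CARD('a pt)"
  shows "coln (\<sigma> i) (\<sigma> j) (\<sigma> l) \<longleftrightarrow> coln i j l"
proof -
  obtain f where f: "f \<in> pgl" "\<sigma> = transport_perm CARD('a pt) psi f"
    using assms(1) by (auto simp: pgl_rep_def)
  have "f (pnt (at_pos a)) = pnt (at_pos (\<sigma> a))" if a: "a < CARD('a pt)" for a
  proof -
    have "f permutes pg_points" using f(1) by (simp add: pgl_def)
    then have "f (pnt (at_pos a)) \<in> pg_points"
      by (simp add: permutes_in_image)
    then obtain p where "f (pnt (at_pos a)) = pnt p"
      using bij_betw_imp_surj_on[OF bij_pnt] by blast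
    with transport_pnt[OF f(1) a this] f(2) show ?thesis by simp
  qed
  then show ?thesis
    unfolding coln_def using pgl_col_iff[OF f(1)] assms by blast
qed

lemma rep_transitive:
  assumes "generic4 e (at_pos i1) (at_pos i2) (at_pos i3) (at_pos i4)"
    and "generic4 e (at_pos j1) (at_pos j2) (at_pos j3) (at_pos j4)"
    and "{i1, i2, i3, i4, j1, j2, j3, j4} \<subseteq> {..<CARD('a pt)}"
  obtains \<sigma> where "\<sigma> \<in> rep" "\<sigma> i1 = j1" "\<sigma> i2 = j2" "\<sigma> i3 = j3" "\<sigma> i4 = j4"
proof -
  obtain f where f: "f \<in> pgl" "f (pnt (at_pos i1)) = pnt (at_pos j1)" "f (pnt (at_pos i2)) = pnt (at_pos j2)"
    "f (pnt (at_pos i3)) = pnt (at_pos j3)" "f (pnt (at_pos i4)) = pnt (at_pos j4)"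
    using pgl_transitive[OF assms(1,2)] by metis
  show ?thesis
  proof (rule that)
    show "transport_perm CARD('a pt) psi f \<in> rep" using f(1) by (auto simp: pgl_rep_def)
  qed (use assms(3) f transport_pnt[OF f(1)] in auto)
qed

lemma finite_rep: "finite rep"
  by (rule finite_subset[OF pgl_rep_group(1)[OF bij_psi] finite_permutations]) simp

text \<open>Inversion permutes the group \<open>rep\<close>, so covering permutations correspond to
  the elements that map \<open>s\<close> to an increasing sequence. By \<open>orbit_count\<close>
  their proportion is that of increasing sequences in the orbit.\<close>

lemma card_covers:
  assumes fin: "finite \<Omega>"
    and stable: "\<And>\<sigma> t. \<lbrakk>\<sigma> \<in> rep; t \<in> \<Omega>\<rbrakk> \<Longrightarrow> map \<sigma> t \<in> \<Omega>"
    and trans: "\<And>t. t \<in> \<Omega> \<Longrightarrow> \<exists>\<sigma>\<in>rep. map \<sigma> s = t"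
    and s: "s \<in> \<Omega>"
    and card: "card \<Omega> = 24 * card {t \<in> \<Omega>. sorted_wrt (<) t}"
  shows "24 * card {\<pi> \<in> rep. covers \<pi> s} = card rep"
proof -
  have inv_inv: "inv (inv \<sigma>) = \<sigma>" if "\<sigma> \<in> rep" for \<sigma>
    using that rep_permutes permutes_inv_inv by blast
  have "bij_betw inv {\<pi> \<in> rep. covers \<pi> s} {\<sigma> \<in> rep. sorted_wrt (<) (map \<sigma> s)}"
    by (rule bij_betw_byWitness[where f' = inv])
      (auto simp: covers_iff_sorted inv_inv pgl_rep_group(4)[OF bij_psi])
  then have "card {\<pi> \<in> rep. covers \<pi> s} = card {\<sigma> \<in> rep. sorted_wrt (<) (map \<sigma> s)}"
    by (rule bij_betw_same_card)
  moreover have "card {\<sigma> \<in> rep. sorted_wrt (<) (map \<sigma> s)} * card \<Omega> = card rep * card {t \<in> \<Omega>. sorted_wrt (<) t}"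
    using rep_permutes pgl_rep_group(3,4)[OF bij_psi] stable trans
    by (intro orbit_count[OF finite_rep fin _ _ _ _ _ s]) (auto intro: permutes_bij)
  moreover have "card \<Omega> > 0" using fin s by (auto simp: card_gt_0_iff)
  ultimately show ?thesis using card by auto
qed

lemma covers_balanced:
  assumes s: "s \<in> distinct_seqs CARD('a pt) 4" and nline: "\<not> pg.all_line (set s)"
  shows "24 * card {\<pi> \<in> rep. covers \<pi> s} = card rep"
proof (cases "pg.has_line (set s)")
  case True
  then obtain p where p: "p \<in> set pg.placements" "s \<in> p ` pg.offs"
    using s nline pg.mixed_seqs by blast
  have map_p: "map \<sigma> (p (a, b, c, d)) = p (\<sigma> a, \<sigma> b, \<sigma> c, \<sigma> d)" for \<sigma> a b c d
    using p(1) by (auto simp: pg.placements_def)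
  \<comment> \<open>The last two points are exchanged since \<open>generic4\<close> expects the
    off-line point in third place.\<close>
  have gen: "generic4 True (at_pos a) (at_pos b) (at_pos d) (at_pos c)" if "(a, b, c, d) \<in> pg.offs" for a b c d
    using that pg.offs_excl[OF that] pg.C_swap12[of c b d] unfolding generic4_def pg.offs_def coln_def by auto
  show ?thesis
  proof (rule card_covers[where \<Omega> = "p ` pg.offs"])
    show "finite (p ` pg.offs)" by (simp add: pg.finite_offs)
    show "map \<sigma> t \<in> p ` pg.offs" if \<sigma>: "\<sigma> \<in> rep" and t: "t \<in> p ` pg.offs" for \<sigma> t
    proof -
      obtain a b c d where o: "(a, b, c, d) \<in> pg.offs" "t = p (a, b, c, d)" using t by auto
      have inj: "inj \<sigma>" using rep_permutes[OF \<sigma>] by (simp add: permutes_inj)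
      have "(\<sigma> a, \<sigma> b, \<sigma> c, \<sigma> d) \<in> pg.offs"
        using o(1) rep_coln[OF \<sigma>] permutes_in_image[OF rep_permutes[OF \<sigma>]]
        by (auto simp: pg.offs_def inj_eq[OF inj])
      then show ?thesis using o(2) map_p by auto
    qed
    show "\<exists>\<sigma>\<in>rep. map \<sigma> s = t" if t: "t \<in> p ` pg.offs" for t
    proof -
      obtain a b c d where o: "(a, b, c, d) \<in> pg.offs" "t = p (a, b, c, d)" using t by auto
      obtain a' b' c' d' where o': "(a', b', c', d') \<in> pg.offs" "s = p (a', b', c', d')" using p(2) by auto
      obtain \<sigma> where "\<sigma> \<in> rep" "\<sigma> a' = a" "\<sigma> b' = b" "\<sigma> d' = d" "\<sigma> c' = c"
        by (rule rep_transitive[OF gen[OF o'(1)] gen[OF o(1)]])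
          (use o(1) o'(1) in \<open>auto simp: pg.offs_def\<close>)
      then show ?thesis using o(2) o'(2) map_p by auto
    qed
    show "card (p ` pg.offs) = 24 * card {t \<in> p ` pg.offs. sorted_wrt (<) t}"
      by (rule pg.placement_card[OF balanced p(1)])
  qed (rule p(2))
next
  case False
  let ?\<Omega> = "{s \<in> distinct_seqs CARD('a pt) 4. \<not> pg.has_line (set s)}"
  have gen: "\<exists>w x y z. t = [w, x, y, z] \<and> {w, x, y, z} \<subseteq> {..<CARD('a pt)}
      \<and> generic4 False (at_pos w) (at_pos x) (at_pos y) (at_pos z)" if t: "t \<in> ?\<Omega>" for t
  proof -
    obtain w x y z where t': "t = [w, x, y, z]"
      using t by (auto simp: distinct_seqs_def numeral_eq_Suc length_Suc_conv)
    have d: "distinct [w, x, y, z]" "{w, x, y, z} \<subseteq> {..<CARD('a pt)}"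
      using t by (auto simp: distinct_seqs_def t')
    have "\<not> coln w x y" "\<not> coln z x y" "\<not> coln w z y" "\<not> coln w x z"
      using t pg.has_line_four(1)[OF d(1)] pg.C_perm(4)[of x y z] pg.C_perm(1)[of w y z] by (auto simp: t')
    then show ?thesis using t' d(2) unfolding generic4_def coln_def by auto
  qed
  show ?thesis
  proof (rule card_covers[where \<Omega> = "?\<Omega>"])
    show "map \<sigma> t \<in> ?\<Omega>" if \<sigma>: "\<sigma> \<in> rep" and t: "t \<in> ?\<Omega>" for \<sigma> t
    proof -
      have inj: "inj \<sigma>" using rep_permutes[OF \<sigma>] by (simp add: permutes_inj)
      have "pg.has_line (set t)" if "pg.has_line (set (map \<sigma> t))"
      proof -
        have "\<And>a. a \<in> set t \<Longrightarrow> a < CARD('a pt)" using t by (auto simp: distinct_seqs_def)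
        then show ?thesis
          using that rep_coln[OF \<sigma>] unfolding pg.has_line_def
          by (simp add: inj_eq[OF inj])
      qed
      then show ?thesis
        using t permutes_in_image[OF rep_permutes[OF \<sigma>]]
        by (auto simp: distinct_seqs_def distinct_map inj_on_subset[OF inj])
    qed
    show "\<exists>\<sigma>\<in>rep. map \<sigma> s = t" if t: "t \<in> ?\<Omega>" for t
    proof -
      have s': "s \<in> ?\<Omega>" using s False by simp
      obtain w x y z where t: "t = [w, x, y, z]" "{w, x, y, z} \<subseteq> {..<CARD('a pt)}"
        "generic4 False (at_pos w) (at_pos x) (at_pos y) (at_pos z)" using gen[OF t] by blast
      obtain w' x' y' z' where s: "s = [w', x', y', z']" "{w', x', y', z'} \<subseteq> {..<CARD('a pt)}"
        "generic4 False (at_pos w') (at_pos x') (at_pos y') (at_pos z')" using gen[OF s'] by blast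
      obtain \<sigma> where "\<sigma> \<in> rep" "\<sigma> w' = w" "\<sigma> x' = x" "\<sigma> y' = y" "\<sigma> z' = z"
        by (rule rep_transitive[OF s(3) t(3)]) (use s(2) t(2) in auto)
      then show ?thesis using s(1) t(1) by auto
    qed
  qed (use s False pg.frame_card in auto)
qed

end

text \<open>Any enumeration of the field serves after recentring; doubling avoids halves when the
  order is even.\<close>

lemma ex_centered_order: "\<exists>k :: 'a::{field,finite} \<Rightarrow> int. centered_order k (int CARD('a))"
proof -
  obtain e :: "'a \<Rightarrow> nat" where e: "bij_betw e UNIV {0..<CARD('a)}"
    using ex_bij_betw_finite_nat[of "UNIV :: 'a set"] by auto
  define k where "k x = 2 * int (e x) - (int CARD('a) - 1)" for x
  have lt: "e x < CARD('a)" for x using bij_betwE[OF e] by auto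
  have "centered_order k (int CARD('a))"
  proof
    show "inj k" using e by (auto simp: k_def inj_on_def bij_betw_def)
    show "\<bar>k x\<bar> < int CARD('a)" for x using lt[of x] by (simp add: k_def abs_if)
    show "\<exists>y. k y = - k x" for x
    proof -
      have "CARD('a) - 1 - e x \<in> e ` UNIV" using e lt[of x] by (simp add: bij_betw_def)
      then obtain y where "e y = CARD('a) - 1 - e x" by auto
      then show ?thesis using lt[of x] by (intro exI[of _ y]) (simp add: k_def of_nat_diff)
    qed
  qed simp
  then show ?thesis by blast
qed

section \<open>The bound on the exceptional sequences\<close>

theorem theorem1p2:
  fixes q r :: nat
  assumes "primepow q"
    and "CARD('a::{field,finite}) = q"
    and "r = q\<^sup>2 + q + 1"
  shows "\<exists>\<psi> :: ('a ^ 3) set \<Rightarrow> nat.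
           bij_betw \<psi> pg_points {..<r} \<and>
           real (card {s \<in> distinct_seqs r 4.
                         real (card {\<pi> \<in> pgl_rep r \<psi>. covers \<pi> s})
                           = real (card (pgl_rep r \<psi>)) / fact 4})
             > (1 - 1 / real q) * real (card (distinct_seqs r 4))"
proof -
  obtain k :: "'a \<Rightarrow> int" where "centered_order k (int CARD('a))"
    using ex_centered_order by blast
  then interpret centered_order k "int CARD('a)" .
  have r: "r = CARD('a pt)" using assms by (simp add: card_pt)
  have q: "q \<ge> 2" using assms(1) primepow_gt_Suc_0 by (simp add: Suc_le_eq numeral_2_eq_2)
  define N where "N = card (distinct_seqs r 4)"
  let ?Q = "{s \<in> distinct_seqs r 4. pg.all_line (set s)}"
  let ?G = "{s \<in> distinct_seqs r 4. real (card {\<pi> \<in> pgl_rep r psi. covers \<pi> s})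
                           = real (card (pgl_rep r psi)) / fact 4}"
  \<comment> \<open>Only sequences inside a line can fail, so it suffices to bound their number by a
    fraction below \<open>1 / q\<close>.\<close>
  have "distinct_seqs r 4 - ?Q \<subseteq> ?G"
  proof
    fix s assume s: "s \<in> distinct_seqs r 4 - ?Q"
    then have "24 * card {\<pi> \<in> pgl_rep r psi. covers \<pi> s} = card (pgl_rep r psi)"
      using covers_balanced[of s] by (simp add: r)
    then have "24 * real (card {\<pi> \<in> pgl_rep r psi. covers \<pi> s}) = real (card (pgl_rep r psi))"
      by (metis of_nat_mult of_nat_numeral)
    then show "s \<in> ?G" using s by (simp add: fact_numeral)
  qed
  then have "N - card ?Q \<le> card ?G"
    unfolding N_def by (intro order.trans[OF diff_card_le_card_Diff card_mono]) auto
  then have G: "real N - real (card ?Q) \<le> real (card ?G)" by linarith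
  have "card ?Q \<le> r * (r - 1) * (q - 1)\<^sup>2"
    using pg.card_all_line assms(2) by (simp add: r)
  then have Q: "real (card ?Q) \<le> real (r * (r - 1) * (q - 1)\<^sup>2)" by (rule of_nat_mono)
  have r4: "r \<ge> 7" using q mult_mono[of 2 q 2 q] by (simp add: assms(3) power2_eq_square)
  have "N = \<Prod>{r - 4 + 1..r}"
    unfolding N_def distinct_seqs_def using card_lists_distinct_length_eq[of "{..<r}" 4] r4 by simp
  also have "{r - 4 + 1..r} = {r - 3, r - 2, r - 1, r}" using r4 by auto
  also have "\<Prod>\<dots> = r * (r - 1) * ((r - 2) * (r - 3))"
  proof -
    obtain t where "r = t + 3" using r4 le_Suc_ex[of 3 r] by (auto simp: add.commute)
    then show ?thesis by (simp add: algebra_simps)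
  qed
  finally have N: "N = r * (r - 1) * ((r - 2) * (r - 3))" .
  \<comment> \<open>After cancelling \<open>r * (r - 1)\<close>, the choices for the first two
    entries, this compares \<open>q\<close> times the bound for collinear sequences with the number
    of all sequences.\<close>
  have "q * (q - 1)\<^sup>2 < (r - 2) * (r - 3)"
  proof -
    \<comment> \<open>Writing \<open>q = u + 2\<close> removes the truncated subtractions and leaves
      polynomials with nonnegative coefficients.\<close>
    obtain u where u: "q = u + 2" using q le_Suc_ex[of 2 q] by (auto simp: add.commute)
    have "r - 2 = u * u + 5 * u + 5" "r - 3 = u * u + 5 * u + 4"
      by (simp_all add: assms(3) u power2_eq_square algebra_simps)
    then show ?thesis by (simp add: u power2_eq_square algebra_simps)
  qed
  then have "q * (r * (r - 1) * (q - 1)\<^sup>2) < N"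
    unfolding N using r4 by (simp add: mult.left_commute)
  then have "real q * real (r * (r - 1) * (q - 1)\<^sup>2) < real N"
    by (metis of_nat_less_iff of_nat_mult)
  with Q q have "real q * real (card ?Q) < real N"
    by (smt (verit) mult_left_mono of_nat_0_le_iff)
  then have "real (card ?Q) < real N / real q"
    using q by (simp add: field_simps)
  with G have "real (card ?G) > (1 - 1 / real q) * real N"
    by (simp add: algebra_simps)
  then show ?thesis
    using bij_psi unfolding N_def r by blast
qed

end
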